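(* Let $d \ge 3$ and $n \ge 1$ be integers, let $\mathbb{k}$ be an algebraically closed field with $\operatorname{char}\mathbb{k} = 0$ or $\operatorname{char}\mathbb{k} > d$, and let $f \in \mathbb{k}[x_1,\dots,x_n]$ be a nondegenerate form of degree $d$. Then the center $Z(f)$ is nonsemisimple if and only if $f$ is an LDS form (a limit of direct sums form).
   Context: A form of degree $d$ in $n$ variables is a homogeneous polynomial of degree $d$ in $\mathbb{k}[x_1,\dots,x_n]$ (a linear combination of monomials of degree $d$). It is nondegenerate if no variable can be removed by an invertible linear change of variables; equivalently, the partial derivatives $\frac{\partial f}{\partial x_1},\dots,\frac{\partial f}{\partial x_n}$ are linearly independent over $\mathbb{k}$. For $f$ with Hessian matrix $H = \left(\frac{\partial^2 f}{\partial x_i \partial x_j}\right)_{1\le i,j\le n}$, the center of $f$ is $$Z(f) := \{X \in \mathbb{k}^{n\times n} \mid (HX)^T = HX\}.$$ It is known that for $f$ nondegenerate, $Z(f)$ is a commutative subalgebra of the full matrix algebra $\mathbb{k}^{n\times n}$; semisimplicity refers to this finite-dimensional $\mathbb{k}$-algebra. A form $f$ of degree $d$ is called a limit of direct sums (LDS) form if, after an invertible linear change of variables, it can be written as $$f(x_1,\dots,x_n) = \sum_{i=1}^{l} x_i \frac{\partial h(x_{l+1},\dots,x_{2l})}{\partial x_{l+i}} + g(x_{l+1},\dots,x_n)$$ for some integer $l$ with $l \ge 1$ and $2l \le n$, where $h$ and $g$ are forms of degree $d$ in $l$ and $n-l$ variables respectively. *)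

theory Defs
  imports
    "HOL-Library.Poly_Mapping"
    "HOL-Computational_Algebra.Polynomial"
    "HOL-Algebra.AbelCoset"
    "Jordan_Normal_Form.Matrix"
begin

text \<open>
  A polynomial is a finitely supported map from monomials (exponent vectors) to coefficients,
  with the convolution product of \<^theory>\<open>HOL-Library.Poly_Mapping\<close>. Variables are indexed
  from \<open>0\<close>, as matrix entries are: \<open>x_1, \<dots>, x_n\<close> are \<open>mvar 0, \<dots>, mvar (n - 1)\<close>.
\<close>

type_synonym 'k mpoly = "(nat \<Rightarrow>\<^sub>0 nat) \<Rightarrow>\<^sub>0 'k"

definition mvar :: "nat \<Rightarrow> 'k::comm_ring_1 mpoly" where
  "mvar i = Poly_Mapping.single (Poly_Mapping.single i 1) 1"

definition mconst :: "'k::comm_ring_1 \<Rightarrow> 'k mpoly" where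
  "mconst c = Poly_Mapping.single 0 c"

definition mvars :: "'k::comm_ring_1 mpoly \<Rightarrow> nat set" where
  "mvars p = (\<Union>m \<in> Poly_Mapping.keys p. Poly_Mapping.keys m)"

definition monom_degree :: "(nat \<Rightarrow>\<^sub>0 nat) \<Rightarrow> nat" where
  "monom_degree m = (\<Sum>i \<in> Poly_Mapping.keys m. Poly_Mapping.lookup m i)"

text \<open>The zero polynomial is a form of every degree.\<close>

definition is_form :: "nat \<Rightarrow> nat \<Rightarrow> 'k::comm_ring_1 mpoly \<Rightarrow> bool" where
  "is_form d n p \<longleftrightarrow>
     mvars p \<subseteq> {..<n} \<and> (\<forall>m \<in> Poly_Mapping.keys p. monom_degree m = d)"

text \<open>
  In the summand of a monomial not containing \<open>x_i\<close>, the subtraction of exponents truncates,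
  but the coefficient is \<open>0\<close>.
\<close>

definition mpderiv :: "nat \<Rightarrow> 'k::comm_ring_1 mpoly \<Rightarrow> 'k mpoly" where
  "mpderiv i p =
     (\<Sum>m \<in> Poly_Mapping.keys p.
        Poly_Mapping.single (m - Poly_Mapping.single i 1)
          (of_nat (Poly_Mapping.lookup m i) * Poly_Mapping.lookup p m))"

definition msubst :: "(nat \<Rightarrow> 'k::comm_ring_1 mpoly) \<Rightarrow> 'k mpoly \<Rightarrow> 'k mpoly" where
  "msubst \<sigma> p =
     (\<Sum>m \<in> Poly_Mapping.keys p.
        mconst (Poly_Mapping.lookup p m) *
        (\<Prod>i \<in> Poly_Mapping.keys m. \<sigma> i ^ Poly_Mapping.lookup m i))"

text \<open>The linear substitution \<open>p (P x)\<close>, where \<open>x\<close> is the column of the first \<open>n\<close> variables.\<close>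

definition lin_subst :: "nat \<Rightarrow> 'k::comm_ring_1 mat \<Rightarrow> 'k mpoly \<Rightarrow> 'k mpoly" where
  "lin_subst n P p = msubst (\<lambda>i. \<Sum>j<n. mconst (P $$ (i, j)) * mvar j) p"

text \<open>
  Renaming \<open>p (x_1, x_2, \<dots>)\<close> to \<open>p (x_{l+1}, x_{l+2}, \<dots>)\<close>.
\<close>

definition shift_vars :: "nat \<Rightarrow> 'k::comm_ring_1 mpoly \<Rightarrow> 'k mpoly" where
  "shift_vars l p = msubst (\<lambda>i. mvar (l + i)) p"

text \<open>No invertible linear change of variables removes a variable.\<close>

definition nondegenerate :: "nat \<Rightarrow> 'k::comm_ring_1 mpoly \<Rightarrow> bool" where
  "nondegenerate n f \<longleftrightarrow>
     (\<forall>P \<in> carrier_mat n n. invertible_mat P \<longrightarrow> (\<forall>i<n. i \<in> mvars (lin_subst n P f)))"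

definition hessian :: "nat \<Rightarrow> 'k::comm_ring_1 mpoly \<Rightarrow> 'k mpoly mat" where
  "hessian n f = mat n n (\<lambda>(i, j). mpderiv i (mpderiv j f))"

definition center :: "nat \<Rightarrow> 'k::comm_ring_1 mpoly \<Rightarrow> 'k mat set" where
  "center n f =
     {X \<in> carrier_mat n n.
        transpose_mat (hessian n f * map_mat mconst X) = hessian n f * map_mat mconst X}"

definition center_algebra :: "nat \<Rightarrow> 'k::comm_ring_1 mpoly \<Rightarrow> 'k mat ring" where
  "center_algebra n f = (ring_mat TYPE('k) n ())\<lparr>carrier := center n f\<rparr>"

definition is_LDS :: "nat \<Rightarrow> nat \<Rightarrow> 'k::comm_ring_1 mpoly \<Rightarrow> bool" where
  "is_LDS d n f \<longleftrightarrow>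
     (\<exists>P \<in> carrier_mat n n. invertible_mat P \<and>
       (\<exists>l h g. 1 \<le> l \<and> 2 * l \<le> n \<and> is_form d l h \<and> is_form d (n - l) g \<and>
          lin_subst n P f =
            (\<Sum>i<l. mvar i * mpderiv (l + i) (shift_vars l h)) + shift_vars l g))"

definition left_ideal :: "'a set \<Rightarrow> ('a, 'b) ring_scheme \<Rightarrow> bool" where
  "left_ideal I R \<longleftrightarrow>
     additive_subgroup I R \<and> (\<forall>a \<in> carrier R. \<forall>x \<in> I. a \<otimes>\<^bsub>R\<^esub> x \<in> I)"

definition simple_left_ideal :: "'a set \<Rightarrow> ('a, 'b) ring_scheme \<Rightarrow> bool" where
  "simple_left_ideal I R \<longleftrightarrow>
     left_ideal I R \<and> I \<noteq> {\<zero>\<^bsub>R\<^esub>} \<and>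
     (\<forall>J. left_ideal J R \<and> J \<subseteq> I \<longrightarrow> J = {\<zero>\<^bsub>R\<^esub>} \<or> J = I)"

text \<open>
  The left regular module is the internal direct sum of finitely many simple submodules.
  For a unital algebra over a field, the left ideals of the underlying ring are automatically
  subspaces, so semisimplicity as an algebra is semisimplicity of the ring.
\<close>

definition semisimple :: "('a, 'b) ring_scheme \<Rightarrow> bool" where
  "semisimple R \<longleftrightarrow> ring R \<and>
     (\<exists>(m::nat) I. (\<forall>i<m. simple_left_ideal (I i) R) \<and>
        (\<forall>a \<in> carrier R. \<exists>!x. x \<in> Pi\<^sub>E {..<m} I \<and> a = (\<Oplus>\<^bsub>R\<^esub>i\<in>{..<m}. x i)))"

end

theory Submission
  imports
    Defs
    "HOL-Library.Function_Algebras"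
    "HOL-Algebra.Multiplicative_Group"
    "HOL-Algebra.Subrings"
    "Jordan_Normal_Form.Determinant"
begin

text \<open>
  A matrix \<open>X\<close> lies in the center exactly if it is self-adjoint for the second derivatives,
  \<open>D(Xa) D(b) f = D(a) D(Xb) f\<close>. Since the third derivatives form a symmetric trilinear form
  with no kernel, the center is a commutative ring, and being finite-dimensional it is semisimple
  if and only if it contains no \<open>X \<noteq> 0\<close> with \<open>X\<^sup>2 = 0\<close>. In a basis in which such an \<open>X\<close> maps
  \<open>e_{l+i}\<close> to \<open>e_i\<close> for \<open>i \<le> l\<close> and kills all the other basis vectors, self-adjointness says that
  the partial derivatives \<open>\<partial>f/\<partial>x_i\<close> with \<open>i \<le> l\<close> involve only \<open>x_{l+1}, \<dots>, x_{2l}\<close> and form a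
  closed system there; by Euler's identity they are the partial derivatives of
  \<open>h = (1/d) \<Sum> x_{l+i} \<partial>f/\<partial>x_i\<close>, which is the LDS shape. Conversely, in LDS coordinates
  that \<open>X\<close> lies in the center.
\<close>

section \<open>Calculus of polynomials\<close>

text \<open>Square-zero elements stand in for arbitrary nilpotent ones: a nonzero nilpotent element
  has a nonzero power of square zero, and X^2 = 0 allows only Jordan blocks of size at most 2. The
  number l is then the rank of X, and 2l \<le> n expresses that the image of X lies in its kernel.
  Finite dimension enters the semisimplicity criterion only through the linear dependence of more
  than n^2 matrices. Applied to the powers of a it yields a^r = c a^(r+1), which in the absence of
  nilpotents improves to a = c a^2; applied to orthogonal idempotents it bounds their number, and a
  longest family of them cuts the ring into simple ideals. The bound d \<ge> 3 makes third
  derivatives meaningful: if they all vanish in a direction c, Euler's identity is applied in the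
  positive degrees d - 2 and d - 1 to conclude D(c) f = 0. The characteristic enters through
  division by integers between 1 and d: exponents, when a vanishing partial derivative must mean
  that the variable is absent, and degrees, in Euler's identity.\<close>

lemma lookup_mpderiv:
  "Poly_Mapping.lookup (mpderiv i p) m =
     of_nat (Poly_Mapping.lookup m i + 1) * Poly_Mapping.lookup p (m + Poly_Mapping.single i 1)"
proof -
  let ?e = "Poly_Mapping.single i (1::nat)"
  \<comment> \<open>Subtracting \<open>?e\<close> can be undone only on monomials that contain the
    variable; on the others the exponent factor is 0.\<close>
  have sub: "m' - ?e = m \<longleftrightarrow> m' = m + ?e" if "Poly_Mapping.lookup m' i \<noteq> 0" for m'
  proof
    assume h: "m' - ?e = m"
    show "m' = m + ?e"
      using that by (intro poly_mapping_eqI) (auto simp: h[symmetric] lookup_add lookup_minus lookup_single when_def)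
  qed simp
  have "Poly_Mapping.lookup (mpderiv i p) m =
    (\<Sum>m'\<in>Poly_Mapping.keys p. of_nat (Poly_Mapping.lookup m' i) * Poly_Mapping.lookup p m' when m' - ?e = m)"
    by (simp add: mpderiv_def lookup_sum lookup_single)
  also have "\<dots> = (\<Sum>m'\<in>Poly_Mapping.keys p. if m' = m + ?e then of_nat (Poly_Mapping.lookup m' i) * Poly_Mapping.lookup p m' else 0)"
  proof (intro sum.cong refl)
    fix m' assume "m' \<in> Poly_Mapping.keys p"
    show "(of_nat (Poly_Mapping.lookup m' i) * Poly_Mapping.lookup p m' when m' - ?e = m) =
      (if m' = m + ?e then of_nat (Poly_Mapping.lookup m' i) * Poly_Mapping.lookup p m' else 0)"
      using sub[of m'] by (cases "Poly_Mapping.lookup m' i = 0") (auto simp: when_def)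
  qed
  also have "\<dots> = of_nat (Poly_Mapping.lookup m i + 1) * Poly_Mapping.lookup p (m + ?e)"
    by (auto simp: sum.delta' lookup_add in_keys_iff)
  finally show ?thesis .
qed

lemma mpderiv_add: "mpderiv i (p + q) = mpderiv i p + mpderiv i q"
  by (intro poly_mapping_eqI) (simp add: lookup_mpderiv lookup_add algebra_simps)

lemma mpderiv_zero [simp]: "mpderiv i 0 = 0"
  by (intro poly_mapping_eqI) (simp add: lookup_mpderiv)

lemma mpderiv_minus: "mpderiv i (p - q) = mpderiv i p - mpderiv i q"
  by (intro poly_mapping_eqI) (simp add: lookup_mpderiv lookup_minus algebra_simps)

lemma mpderiv_sum: "mpderiv i (sum g A) = (\<Sum>x\<in>A. mpderiv i (g x))"
  by (induction A rule: infinite_finite_induct) (simp_all add: mpderiv_add)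

lemma mpderiv_commute: "mpderiv i (mpderiv j p) = mpderiv j (mpderiv i p)"
  by (intro poly_mapping_eqI)
    (auto simp: lookup_mpderiv lookup_add lookup_single when_def add_ac mult_ac)

lemma mpderiv_single:
  "mpderiv i (Poly_Mapping.single m c) =
     Poly_Mapping.single (m - Poly_Mapping.single i 1) (of_nat (Poly_Mapping.lookup m i) * c)"
  by (cases "c = 0") (simp_all add: mpderiv_def)

lemma mpoly_eq_sum_single:
  "p = (\<Sum>m\<in>Poly_Mapping.keys p. Poly_Mapping.single m (Poly_Mapping.lookup p m))"
  by (intro poly_mapping_eqI) (simp add: lookup_sum lookup_single when_def sum.delta in_keys_iff)

text \<open>Reduces identities that are additive in each argument, such as the product rule, to
  single monomials.\<close>

lemma mpoly_additive_induct [case_names single add]: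
  fixes p :: "'k::comm_ring_1 mpoly"
  assumes single: "\<And>m c. P (Poly_Mapping.single m c)"
    and add: "\<And>p q. P p \<Longrightarrow> P q \<Longrightarrow> P (p + q)"
  shows "P p"
proof -
  have "P (\<Sum>m\<in>K. Poly_Mapping.single m (Poly_Mapping.lookup p m))" if "finite K" for K
    using that
  proof (induction K)
    case empty
    show ?case using single[of 0 0] by simp
  qed (simp add: single add)
  from this[OF finite_keys[of p]] show ?thesis
    by (simp add: mpoly_eq_sum_single[symmetric])
qed

lemma mpderiv_mult: "mpderiv i (p * q) = mpderiv i p * q + p * mpderiv i q"
proof -
  have monomials: "mpderiv i (Poly_Mapping.single m a * Poly_Mapping.single m' b) =
    mpderiv i (Poly_Mapping.single m a) * Poly_Mapping.single m' b
      + Poly_Mapping.single m a * mpderiv i (Poly_Mapping.single m' b)" for m m' and a b :: 'a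
  proof -
    let ?e = "Poly_Mapping.single i (1::nat)"
    \<comment> \<open>If the variable is absent from \<open>m\<close>, truncation can make the two
      monomials differ, but then both coefficients are 0. The same happens in \<open>2\<close> with
      \<open>m'\<close>.\<close>
    have 1: "Poly_Mapping.single (m + m' - ?e) (of_nat (Poly_Mapping.lookup m i) * a * b) =
        Poly_Mapping.single (m - ?e + m') (of_nat (Poly_Mapping.lookup m i) * a * b)"
    proof (cases "Poly_Mapping.lookup m i = 0")
      case False
      then have "m + m' - ?e = m - ?e + m'"
        by (intro poly_mapping_eqI) (auto simp: lookup_add lookup_minus lookup_single when_def)
      then show ?thesis by simp
    qed simp
    have 2: "Poly_Mapping.single (m + m' - ?e) (of_nat (Poly_Mapping.lookup m' i) * a * b) =
        Poly_Mapping.single (m + (m' - ?e)) (of_nat (Poly_Mapping.lookup m' i) * a * b)"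
    proof (cases "Poly_Mapping.lookup m' i = 0")
      case False
      then have "m + m' - ?e = m + (m' - ?e)"
        by (intro poly_mapping_eqI) (auto simp: lookup_add lookup_minus lookup_single when_def)
      then show ?thesis by simp
    qed simp
    have "mpderiv i (Poly_Mapping.single m a * Poly_Mapping.single m' b) =
        Poly_Mapping.single (m + m' - ?e) (of_nat (Poly_Mapping.lookup m i) * a * b) +
        Poly_Mapping.single (m + m' - ?e) (of_nat (Poly_Mapping.lookup m' i) * a * b)"
      by (simp add: mult_single mpderiv_single lookup_add distrib_right single_add mult.assoc)
    then show ?thesis
      unfolding 1 2 by (simp add: mult_single mpderiv_single mult_ac add.commute)
  qed
  show ?thesis
  proof (induction p rule: mpoly_additive_induct)
    case (single m a)
    show ?case
      by (induction q rule: mpoly_additive_induct)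
        (simp_all add: monomials mpderiv_add distrib_left add_ac)
  qed (simp_all add: mpderiv_add algebra_simps)
qed

lemma mpderiv_mconst [simp]: "mpderiv i (mconst c) = 0"
  by (simp add: mconst_def mpderiv_single)

lemma mpderiv_mvar: "mpderiv i (mvar j) = (if i = j then 1 else 0)"
  by (auto simp: mvar_def mpderiv_single lookup_single when_def)

lemma mconst_add: "mconst (a + b) = mconst a + mconst b"
  by (simp add: mconst_def single_add)

lemma mconst_mult: "mconst (a * b) = mconst a * mconst b"
  by (simp add: mconst_def mult_single)

lemma mconst_zero [simp]: "mconst 0 = 0"
  by (simp add: mconst_def)

lemma mconst_one [simp]: "mconst 1 = 1"
  by (simp add: mconst_def)

lemma mconst_sum: "mconst (sum g A) = (\<Sum>x\<in>A. mconst (g x))"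
  by (induction A rule: infinite_finite_induct) (simp_all add: mconst_add)

lemma mpderiv_mconst_mult [simp]: "mpderiv i (mconst c * p) = mconst c * mpderiv i p"
  by (simp add: mpderiv_mult)

lemma lookup_mconst_mult: "Poly_Mapping.lookup (mconst c * p) m = c * Poly_Mapping.lookup p m"
proof -
  have "mconst c * p = Poly_Mapping.map ((*) c) p"
    by (simp add: mconst_def mult_map_scale_conv_mult)
  then show ?thesis by (simp add: map.rep_eq when_def)
qed

lemma lookup_mvar_mult:
  "Poly_Mapping.lookup (mvar i * p) m =
     (if Poly_Mapping.lookup m i = 0 then 0
      else Poly_Mapping.lookup p (m - Poly_Mapping.single i 1))"
proof -
  let ?e = "Poly_Mapping.single i (1::nat)"
  have sub: "?e + m' = m \<longleftrightarrow> Poly_Mapping.lookup m i \<noteq> 0 \<and> m' = m - ?e" for m'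
  proof
    assume "Poly_Mapping.lookup m i \<noteq> 0 \<and> m' = m - ?e"
    then show "?e + m' = m"
      by (intro poly_mapping_eqI) (auto simp: lookup_add lookup_minus lookup_single when_def)
  qed (auto simp: lookup_add)
  have "mvar i * p = (\<Sum>m'\<in>Poly_Mapping.keys p. Poly_Mapping.single (?e + m') (Poly_Mapping.lookup p m'))"
    by (subst mpoly_eq_sum_single[of p]) (simp add: sum_distrib_left mvar_def mult_single)
  then show ?thesis
    by (auto simp: lookup_sum lookup_single when_def sub sum.delta' in_keys_iff simp del: One_nat_def)
qed

section \<open>Induction over monomials and polynomials\<close>

lemma monom_induct [case_names zero add]:
  fixes m :: "nat \<Rightarrow>\<^sub>0 nat"
  assumes "P 0" and "\<And>m i. P m \<Longrightarrow> P (m + Poly_Mapping.single i 1)"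
  shows "P m"
proof -
  have "P (m + Poly_Mapping.single i k)" if "P m" for m i k
  proof (induction k)
    case (Suc k)
    have "m + Poly_Mapping.single i (Suc k) = m + Poly_Mapping.single i k + Poly_Mapping.single i 1"
      by (simp add: single_add[symmetric] add.assoc)
    with Suc assms(2) show ?case by metis
  qed (use that in simp)
  moreover have "Poly_Mapping.update i k m = m + Poly_Mapping.single i k"
    if "i \<notin> Poly_Mapping.keys m" for m :: "nat \<Rightarrow>\<^sub>0 nat" and i k
    using that by (intro poly_mapping_eqI)
      (auto simp: lookup_update lookup_add lookup_single when_def in_keys_iff)
  ultimately show ?thesis
    using assms(1) by (induction m rule: update_induct) simp_all
qed

lemma keys_add_nat:
  fixes m m' :: "nat \<Rightarrow>\<^sub>0 nat"
  shows "Poly_Mapping.keys (m + m') = Poly_Mapping.keys m \<union> Poly_Mapping.keys m'"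
  by (auto simp: in_keys_iff lookup_add)

text \<open>Multiplication by one variable is the inductive step, so facts about substitutions are
  checked on generators only. The bound \<open>V\<close> on the variables is carried along because
  the chain rule sums over a fixed finite set of variables.\<close>

lemma mpoly_induct [consumes 1, case_names const add mult_var]:
  fixes p :: "'k::comm_ring_1 mpoly"
  assumes V: "mvars p \<subseteq> V"
    and const: "\<And>c. P (mconst c)"
    and add: "\<And>p q. P p \<Longrightarrow> P q \<Longrightarrow> P (p + q)"
    and mult_var: "\<And>p i. P p \<Longrightarrow> i \<in> V \<Longrightarrow> P (p * mvar i)"
  shows "P p"
proof -
  have single: "Poly_Mapping.keys m \<subseteq> V \<Longrightarrow> P (Poly_Mapping.single m c)" for m c
  proof (induction m rule: monom_induct)
    case zero
    show ?case using const[of c] by (simp add: mconst_def)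
  next
    case (add m i)
    then have "P (Poly_Mapping.single m c * mvar i)"
      by (intro mult_var) (auto simp: keys_add_nat)
    then show ?case by (simp add: mvar_def mult_single)
  qed
  have "P (\<Sum>m\<in>K. Poly_Mapping.single m (Poly_Mapping.lookup p m))"
    if "K \<subseteq> Poly_Mapping.keys p" for K
  proof -
    have "finite K" using that finite_subset finite_keys by blast
    then show ?thesis using that
    proof (induction K)
      case empty
      show ?case using const[of 0] by simp
    next
      case (insert m K)
      have "Poly_Mapping.keys m \<subseteq> V" using insert.prems V by (auto simp: mvars_def)
      then show ?case using insert by (simp add: add single)
    qed
  qed
  from this[of "Poly_Mapping.keys p"] show ?thesis
    by (simp add: mpoly_eq_sum_single[symmetric])
qed

section \<open>Substitution as a ring homomorphism\<close>

lemma msubst_superset: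
  assumes "finite S" "Poly_Mapping.keys p \<subseteq> S"
  shows "msubst \<sigma> p = (\<Sum>m\<in>S. mconst (Poly_Mapping.lookup p m) *
    (\<Prod>i\<in>Poly_Mapping.keys m. \<sigma> i ^ Poly_Mapping.lookup m i))"
  unfolding msubst_def using assms
  by (intro sum.mono_neutral_left) (auto simp: in_keys_iff)

lemma msubst_add: "msubst \<sigma> (p + q) = msubst \<sigma> p + msubst \<sigma> q"
proof -
  let ?S = "Poly_Mapping.keys p \<union> Poly_Mapping.keys q"
  \<comment> \<open>Cancellation can make the support of \<open>p + q\<close> smaller than the
    union; over the common index set \<open>?S\<close> additivity holds term by term.\<close>
  have "Poly_Mapping.keys (p + q) \<subseteq> ?S" by (rule keys_add)
  then show ?thesis
    by (simp add: msubst_superset[of ?S] lookup_add mconst_add algebra_simps sum.distrib)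
qed

lemma msubst_zero [simp]: "msubst \<sigma> 0 = 0"
  by (simp add: msubst_def)

lemma msubst_sum: "msubst \<sigma> (sum g A) = (\<Sum>x\<in>A. msubst \<sigma> (g x))"
  by (induction A rule: infinite_finite_induct) (simp_all add: msubst_add)

lemma msubst_single: "msubst \<sigma> (Poly_Mapping.single m c) =
    mconst c * (\<Prod>i\<in>Poly_Mapping.keys m. \<sigma> i ^ Poly_Mapping.lookup m i)"
  by (cases "c = 0") (simp_all add: msubst_def)

lemma msubst_mconst [simp]: "msubst \<sigma> (mconst c) = mconst c"
  by (simp add: mconst_def[of c] msubst_single)

lemma msubst_one [simp]: "msubst \<sigma> 1 = 1"
  using msubst_mconst[of \<sigma> 1] by simp

lemma msubst_mvar [simp]: "msubst \<sigma> (mvar i) = \<sigma> i"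
  by (simp add: mvar_def msubst_single)

lemma msubst_mult: "msubst \<sigma> (p * q) = msubst \<sigma> p * msubst \<sigma> q"
proof -
  have mono: "(\<Prod>i\<in>Poly_Mapping.keys (m + m'). \<sigma> i ^ Poly_Mapping.lookup (m + m') i) =
    (\<Prod>i\<in>Poly_Mapping.keys m. \<sigma> i ^ Poly_Mapping.lookup m i) *
    (\<Prod>i\<in>Poly_Mapping.keys m'. \<sigma> i ^ Poly_Mapping.lookup m' i)" for m m'
  proof -
    let ?U = "Poly_Mapping.keys m \<union> Poly_Mapping.keys m'"
    have "(\<Prod>i\<in>Poly_Mapping.keys m. \<sigma> i ^ Poly_Mapping.lookup m i) = (\<Prod>i\<in>?U. \<sigma> i ^ Poly_Mapping.lookup m i)"
      "(\<Prod>i\<in>Poly_Mapping.keys m'. \<sigma> i ^ Poly_Mapping.lookup m' i) = (\<Prod>i\<in>?U. \<sigma> i ^ Poly_Mapping.lookup m' i)"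
      by (intro prod.mono_neutral_left; auto simp: in_keys_iff)+
    then show ?thesis
      by (simp add: keys_add_nat lookup_add power_add prod.distrib)
  qed
  have monomials: "msubst \<sigma> (Poly_Mapping.single m a * Poly_Mapping.single m' b) =
      msubst \<sigma> (Poly_Mapping.single m a) * msubst \<sigma> (Poly_Mapping.single m' b)" for m m' a b
    by (simp add: mult_single msubst_single mono mconst_mult mult_ac)
  show ?thesis
  proof (induction p rule: mpoly_additive_induct)
    case (single m a)
    show ?case
      by (induction q rule: mpoly_additive_induct)
        (simp_all add: monomials msubst_add distrib_left)
  qed (simp_all add: msubst_add distrib_right)
qed

lemma msubst_cong:
  assumes "\<And>i. i \<in> mvars p \<Longrightarrow> \<sigma> i = \<tau> i"
  shows "msubst \<sigma> p = msubst \<tau> p"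
  unfolding msubst_def
proof (intro sum.cong refl arg_cong2[where f = "(*)"] prod.cong)
  fix m i assume "m \<in> Poly_Mapping.keys p" "i \<in> Poly_Mapping.keys m"
  then show "\<sigma> i ^ Poly_Mapping.lookup m i = \<tau> i ^ Poly_Mapping.lookup m i"
    using assms[of i] by (metis UN_I mvars_def)
qed

lemma msubst_msubst:
  "msubst \<tau> (msubst \<sigma> p) = msubst (\<lambda>i. msubst \<tau> (\<sigma> i)) p"
  by (induction p rule: mpoly_induct[OF subset_UNIV]) (simp_all add: msubst_add msubst_mult)

lemma msubst_ident: "msubst mvar p = p"
  by (induction p rule: mpoly_induct[OF subset_UNIV]) (simp_all add: msubst_add msubst_mult)

section \<open>Occurring variables and the chain rule\<close>

lemma mvars_add: "mvars (p + q) \<subseteq> mvars p \<union> mvars q"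
  using keys_add[of p q] by (auto simp: mvars_def)

lemma mvars_mult: "mvars (p * q) \<subseteq> mvars p \<union> mvars q"
proof
  fix i assume "i \<in> mvars (p * q)"
  then obtain a b where "a \<in> Poly_Mapping.keys p" "b \<in> Poly_Mapping.keys q"
    "i \<in> Poly_Mapping.keys (a + b)"
    using keys_mult[of p q] by (auto simp: mvars_def)
  then show "i \<in> mvars p \<union> mvars q" by (auto simp: mvars_def keys_add_nat)
qed

lemma mvars_zero [simp]: "mvars 0 = {}"
  by (simp add: mvars_def)

lemma mvars_mconst [simp]: "mvars (mconst c) = {}"
  by (auto simp: mvars_def mconst_def)

lemma mvars_mvar [simp]: "mvars (mvar i :: 'k::comm_ring_1 mpoly) = {i}"
  by (auto simp: mvars_def mvar_def)

lemma mvars_msubst: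
  assumes "\<And>i. i \<in> mvars p \<Longrightarrow> mvars (\<sigma> i) \<subseteq> W"
  shows "mvars (msubst \<sigma> p) \<subseteq> W"
proof -
  have "mvars p \<subseteq> {i. mvars (\<sigma> i) \<subseteq> W}" using assms by auto
  then show ?thesis
  proof (induction p rule: mpoly_induct)
    case (add p q)
    then show ?case using mvars_add[of "msubst \<sigma> p" "msubst \<sigma> q"] by (auto simp: msubst_add)
  next
    case (mult_var p i)
    then show ?case using mvars_mult[of "msubst \<sigma> p" "\<sigma> i"] by (auto simp: msubst_mult)
  qed simp
qed

lemma mpderiv_eq_0_of_notin_mvars: "i \<notin> mvars p \<Longrightarrow> mpderiv i p = 0"
proof (intro poly_mapping_eqI)
  fix m assume "i \<notin> mvars p"
  then have "m + Poly_Mapping.single i 1 \<notin> Poly_Mapping.keys p"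
    by (auto simp: mvars_def keys_add_nat)
  then show "Poly_Mapping.lookup (mpderiv i p) m = Poly_Mapping.lookup 0 m"
    by (simp add: lookup_mpderiv in_keys_iff)
qed

text \<open>Chain rule. Both sides obey the same product rule in \<open>p\<close>, so it passes from
  \<open>p\<close> to \<open>p * mvar k\<close>; the new term is the summand i = k.\<close>

lemma mpderiv_msubst:
  assumes "mvars p \<subseteq> V" "finite V"
  shows "mpderiv j (msubst \<sigma> p) = (\<Sum>i\<in>V. msubst \<sigma> (mpderiv i p) * mpderiv j (\<sigma> i))"
  using assms(1)
proof (induction p rule: mpoly_induct)
  case (const c)
  show ?case by simp
next
  case (add p q)
  then show ?case by (simp add: mpderiv_add msubst_add sum.distrib algebra_simps)
next
  case (mult_var p k)
  have "(\<Sum>i\<in>V. msubst \<sigma> (mpderiv i (p * mvar k)) * mpderiv j (\<sigma> i)) =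
    (\<Sum>i\<in>V. msubst \<sigma> (mpderiv i p) * mpderiv j (\<sigma> i) * \<sigma> k
       + (if i = k then msubst \<sigma> p * mpderiv j (\<sigma> k) else 0))"
    by (intro sum.cong refl) (simp add: mpderiv_mult mpderiv_mvar msubst_add msubst_mult algebra_simps)
  also have "\<dots> = mpderiv j (msubst \<sigma> p) * \<sigma> k + msubst \<sigma> p * mpderiv j (\<sigma> k)"
    using assms(2) mult_var by (simp add: sum.distrib sum.delta' sum_distrib_right)
  finally show ?case by (simp add: msubst_mult mpderiv_mult)
qed

section \<open>Degree and homogeneity\<close>

lemma monom_degree_superset:
  assumes "finite S" "Poly_Mapping.keys m \<subseteq> S"
  shows "monom_degree m = (\<Sum>i\<in>S. Poly_Mapping.lookup m i)"
  unfolding monom_degree_def using assms by (intro sum.mono_neutral_left) (auto simp: in_keys_iff)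

lemma monom_degree_add: "monom_degree (m + m') = monom_degree m + monom_degree m'"
  using monom_degree_superset[of "Poly_Mapping.keys m \<union> Poly_Mapping.keys m'" m]
    monom_degree_superset[of "Poly_Mapping.keys m \<union> Poly_Mapping.keys m'" m']
    monom_degree_superset[of "Poly_Mapping.keys m \<union> Poly_Mapping.keys m'" "m + m'"]
  by (simp add: keys_add_nat lookup_add sum.distrib)

lemma monom_degree_single [simp]: "monom_degree (Poly_Mapping.single i k) = k"
  by (cases "k = 0") (simp_all add: monom_degree_def)

lemma lookup_le_monom_degree: "Poly_Mapping.lookup m i \<le> monom_degree m"
proof (cases "i \<in> Poly_Mapping.keys m")
  case True
  then show ?thesis
    unfolding monom_degree_def by (intro member_le_sum) auto
qed (simp add: in_keys_iff)

text \<open>The degree condition of \<open>is_form\<close> alone: the shifted polynomials of the LDS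
  shape use a block of variables that does not start at 0, so their variables are tracked
  separately.\<close>

definition homogeneous :: "nat \<Rightarrow> 'k::comm_ring_1 mpoly \<Rightarrow> bool" where
  "homogeneous d p \<longleftrightarrow> (\<forall>m \<in> Poly_Mapping.keys p. monom_degree m = d)"

lemma is_form_iff: "is_form d n p \<longleftrightarrow> mvars p \<subseteq> {..<n} \<and> homogeneous d p"
  by (simp add: is_form_def homogeneous_def)

lemma homogeneous_zero [simp]: "homogeneous d 0"
  by (simp add: homogeneous_def)

lemma homogeneous_mconst [simp]: "homogeneous 0 (mconst c)"
  by (auto simp: homogeneous_def mconst_def monom_degree_def)

lemma homogeneous_one [simp]: "homogeneous 0 1"
  using homogeneous_mconst[of 1] by simp

lemma homogeneous_mvar: "homogeneous 1 (mvar i)"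
  by (auto simp: homogeneous_def mvar_def)

lemma homogeneous_add: "homogeneous d p \<Longrightarrow> homogeneous d q \<Longrightarrow> homogeneous d (p + q)"
  using keys_add[of p q] by (auto simp: homogeneous_def)

lemma homogeneous_minus: "homogeneous d p \<Longrightarrow> homogeneous d q \<Longrightarrow> homogeneous d (p - q)"
  by (force simp: homogeneous_def in_keys_iff lookup_minus)

lemma homogeneous_sum: "(\<And>x. x \<in> A \<Longrightarrow> homogeneous d (g x)) \<Longrightarrow> homogeneous d (sum g A)"
  by (induction A rule: infinite_finite_induct) (simp_all add: homogeneous_add)

lemma homogeneous_mult:
  "homogeneous d p \<Longrightarrow> homogeneous e q \<Longrightarrow> homogeneous (d + e) (p * q)"
  using keys_mult[of p q] by (force simp: homogeneous_def monom_degree_add)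

lemma homogeneous_power: "homogeneous d p \<Longrightarrow> homogeneous (k * d) (p ^ k)"
  by (induction k) (simp_all add: homogeneous_mult)

lemma homogeneous_prod:
  "(\<And>x. x \<in> A \<Longrightarrow> homogeneous (e x) (g x)) \<Longrightarrow> homogeneous (sum e A) (prod g A)"
  by (induction A rule: infinite_finite_induct) (simp_all add: homogeneous_mult)

lemma homogeneous_msubst:
  assumes "homogeneous d p" "\<And>i. i \<in> mvars p \<Longrightarrow> homogeneous 1 (\<sigma> i)"
  shows "homogeneous d (msubst \<sigma> p)"
  unfolding msubst_def
proof (intro homogeneous_sum)
  fix m assume m: "m \<in> Poly_Mapping.keys p"
  have "homogeneous (\<Sum>i\<in>Poly_Mapping.keys m. Poly_Mapping.lookup m i)
      (\<Prod>i\<in>Poly_Mapping.keys m. \<sigma> i ^ Poly_Mapping.lookup m i)"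
  proof (intro homogeneous_prod)
    fix i assume "i \<in> Poly_Mapping.keys m"
    then have "homogeneous 1 (\<sigma> i)" using m by (intro assms(2)) (auto simp: mvars_def)
    from homogeneous_power[OF this] show "homogeneous (Poly_Mapping.lookup m i) (\<sigma> i ^ Poly_Mapping.lookup m i)"
      by simp
  qed
  moreover have "(\<Sum>i\<in>Poly_Mapping.keys m. Poly_Mapping.lookup m i) = d"
    using m assms(1) by (simp add: homogeneous_def monom_degree_def)
  ultimately show "homogeneous d (mconst (Poly_Mapping.lookup p m) *
      (\<Prod>i\<in>Poly_Mapping.keys m. \<sigma> i ^ Poly_Mapping.lookup m i))"
    using homogeneous_mult[OF homogeneous_mconst] by fastforce
qed

lemma homogeneous_mpderiv: "homogeneous d p \<Longrightarrow> homogeneous (d - 1) (mpderiv i p)"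
proof (unfold homogeneous_def, intro ballI)
  fix m assume hom: "\<forall>m\<in>Poly_Mapping.keys p. monom_degree m = d"
    and "m \<in> Poly_Mapping.keys (mpderiv i p)"
  then have "m + Poly_Mapping.single i 1 \<in> Poly_Mapping.keys p"
    by (auto simp: in_keys_iff lookup_mpderiv)
  then have "monom_degree (m + Poly_Mapping.single i 1) = d" using hom by blast
  then show "monom_degree m = d - 1" by (simp add: monom_degree_add)
qed

lemma mvars_mpderiv: "mvars (mpderiv i p) \<subseteq> mvars p"
proof
  fix j assume "j \<in> mvars (mpderiv i p)"
  then obtain m where "m \<in> Poly_Mapping.keys (mpderiv i p)" "j \<in> Poly_Mapping.keys m"
    by (auto simp: mvars_def)
  then have "m + Poly_Mapping.single i 1 \<in> Poly_Mapping.keys p"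
    "j \<in> Poly_Mapping.keys (m + Poly_Mapping.single i 1)"
    by (auto simp: in_keys_iff lookup_mpderiv lookup_add)
  then show "j \<in> mvars p" unfolding mvars_def by blast
qed

lemma is_form_mpderiv: "is_form d n p \<Longrightarrow> is_form (d - 1) n (mpderiv i p)"
  using mvars_mpderiv[of i p] homogeneous_mpderiv[of d p i] by (auto simp: is_form_iff)

section \<open>Euler's identity and the role of the characteristic\<close>

lemma euler_identity:
  assumes "homogeneous d p" "mvars p \<subseteq> V" "finite V"
  shows "(\<Sum>i\<in>V. mvar i * mpderiv i p) = mconst (of_nat d) * p"
proof (intro poly_mapping_eqI)
  fix m
  \<comment> \<open>Each monomial is an eigenvector of \<open>mvar i\<close> times the i-th
    derivative, with its exponent as eigenvalue; the exponents add up to the degree.\<close>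
  have "Poly_Mapping.lookup (mvar i * mpderiv i p) m =
      of_nat (Poly_Mapping.lookup m i) * Poly_Mapping.lookup p m" for i
  proof (cases "Poly_Mapping.lookup m i = 0")
    case False
    then have "m - Poly_Mapping.single i 1 + Poly_Mapping.single i 1 = m"
      by (intro poly_mapping_eqI) (auto simp: lookup_add lookup_minus lookup_single when_def)
    moreover have "Suc (Poly_Mapping.lookup m i - Suc 0) = Poly_Mapping.lookup m i"
      using False by simp
    ultimately show ?thesis
      using False by (simp add: lookup_mvar_mult lookup_mpderiv lookup_minus del: of_nat_Suc)
  qed (simp add: lookup_mvar_mult)
  then have "Poly_Mapping.lookup (\<Sum>i\<in>V. mvar i * mpderiv i p) m =
      of_nat (\<Sum>i\<in>V. Poly_Mapping.lookup m i) * Poly_Mapping.lookup p m"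
    by (simp add: lookup_sum sum_distrib_right)
  also have "\<dots> = of_nat d * Poly_Mapping.lookup p m"
  proof (cases "m \<in> Poly_Mapping.keys p")
    case True
    then have "Poly_Mapping.keys m \<subseteq> V" using assms(2) by (auto simp: mvars_def)
    then have "(\<Sum>i\<in>V. Poly_Mapping.lookup m i) = d"
      using monom_degree_superset[OF assms(3), of m] True assms(1) by (simp add: homogeneous_def)
    then show ?thesis by simp
  qed (simp add: in_keys_iff)
  finally show "Poly_Mapping.lookup (\<Sum>i\<in>V. mvar i * mpderiv i p) m =
      Poly_Mapping.lookup (mconst (of_nat d) * p) m"
    by (simp add: lookup_mconst_mult)
qed

lemma of_nat_neq_0_of_char:
  assumes "CHAR('k::comm_ring_1) = 0 \<or> CHAR('k) > d" "0 < k" "k \<le> d"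
  shows "(of_nat k :: 'k) \<noteq> 0"
  using assms by (auto simp: of_nat_eq_0_iff_char_dvd dest: dvd_imp_le)

text \<open>An occurring variable has some exponent between 1 and \<open>d\<close>, which is
  invertible in \<open>'k\<close>, so the derivative keeps that term. In characteristic p the power
  x^p shows that the degree bound matters.\<close>

lemma notin_mvars_of_mpderiv_eq_0:
  fixes p :: "'k::field mpoly"
  assumes "CHAR('k) = 0 \<or> CHAR('k) > d" "homogeneous e p" "e \<le> d" "mpderiv i p = 0"
  shows "i \<notin> mvars p"
proof
  assume "i \<in> mvars p"
  then obtain m where m: "m \<in> Poly_Mapping.keys p" "i \<in> Poly_Mapping.keys m"
    by (auto simp: mvars_def)
  let ?m = "m - Poly_Mapping.single i 1"
  have eq: "?m + Poly_Mapping.single i 1 = m"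
    using m(2) by (intro poly_mapping_eqI)
      (auto simp: lookup_add lookup_minus lookup_single when_def in_keys_iff)
  have pos: "Poly_Mapping.lookup m i > 0" using m(2) by (simp add: in_keys_iff)
  have "Poly_Mapping.lookup m i \<le> d"
    using lookup_le_monom_degree[of m i] assms(2,3) m(1) by (auto simp: homogeneous_def)
  then have "(of_nat (Poly_Mapping.lookup m i) :: 'k) \<noteq> 0"
    using of_nat_neq_0_of_char[OF assms(1) pos] by blast
  moreover have "Poly_Mapping.lookup (mpderiv i p) ?m =
      of_nat (Poly_Mapping.lookup m i) * Poly_Mapping.lookup p m"
    using pos eq by (simp add: lookup_mpderiv lookup_minus del: of_nat_Suc)
  ultimately show False using assms(4) m(1) by (simp add: in_keys_iff)
qed

text \<open>Euler's identity writes \<open>e\<close> times \<open>p\<close> as a combination of its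
  partial derivatives, and \<open>e\<close> is invertible in this characteristic.\<close>

lemma homogeneous_eq_0_of_mpderiv_eq_0:
  fixes p :: "'k::field mpoly"
  assumes "CHAR('k) = 0 \<or> CHAR('k) > d" "is_form e n p" "0 < e" "e \<le> d"
    "\<And>i. i < n \<Longrightarrow> mpderiv i p = 0"
  shows "p = 0"
proof -
  have "mconst (of_nat e) * p = 0"
    using euler_identity[of e p "{..<n}"] assms(2,5) by (simp add: is_form_iff)
  then have "mconst (inverse (of_nat e)) * mconst (of_nat e) * p = 0"
    by (simp add: mult.assoc)
  then show ?thesis
    using of_nat_neq_0_of_char[OF assms(1,3,4)] by (simp add: mconst_mult[symmetric])
qed

section \<open>Semisimple commutative rings\<close>

context cring
begin

lemma left_ideal_cgenideal: "x \<in> carrier R \<Longrightarrow> left_ideal (PIdl x) R"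
  using cgenideal_ideal[of x] unfolding left_ideal_def
  by (auto simp: ideal.axioms(1) ideal.I_l_closed)

lemma left_ideal_subset: "left_ideal J R \<Longrightarrow> J \<subseteq> carrier R"
  by (simp add: left_ideal_def additive_subgroup.a_subset)

lemma cgenideal_subset_left_ideal: "left_ideal J R \<Longrightarrow> x \<in> J \<Longrightarrow> PIdl x \<subseteq> J"
  by (auto simp: left_ideal_def cgenideal_def)

text \<open>Write 1 as the sum of components e_i. If a is not 0, some a e_i is not 0 and generates
  the simple ideal containing e_i, so e_i = c a e_i. As e_i is idempotent, squaring makes it a
  multiple of a^2 = 0.\<close>

lemma semisimple_imp_reduced:
  assumes ss: "semisimple R" and a: "a \<in> carrier R" "a \<otimes> a = \<zero>"
  shows "a = \<zero>"
proof (rule ccontr)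
  assume "a \<noteq> \<zero>"
  obtain m :: nat and I where simple': "\<forall>i<m. simple_left_ideal (I i) R"
    and dec': "\<forall>a\<in>carrier R. \<exists>!x. x \<in> Pi\<^sub>E {..<m} I \<and> a = (\<Oplus>i\<in>{..<m}. x i)"
    using ss unfolding semisimple_def by (elim conjE exE)
  note simple = simple'[rule_format] and dec = dec'[rule_format]
  have left: "left_ideal (I i) R" if "i < m" for i
    using simple[OF that] by (simp add: simple_left_ideal_def)
  have sub: "I i \<subseteq> carrier R" if "i < m" for i
    using left_ideal_subset[OF left[OF that]] .
  obtain e where e: "e \<in> Pi\<^sub>E {..<m} I" and one: "\<one> = (\<Oplus>i\<in>{..<m}. e i)"
    using ex1_implies_ex[OF dec[OF one_closed]] by (elim exE conjE)
  have eI: "e i \<in> I i" and ec: "e i \<in> carrier R" if "i < m" for i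
    using e sub that by (auto simp: PiE_iff)
  have ae: "b = (\<Oplus>i\<in>{..<m}. b \<otimes> e i)" if "b \<in> carrier R" for b
    using finsum_rdistr[of "{..<m}" b e] that ec by (simp add: Pi_iff one[symmetric])
  have "\<exists>i<m. a \<otimes> e i \<noteq> \<zero>"
  proof (rule ccontr)
    assume "\<not> ?thesis"
    then have "(\<Oplus>i\<in>{..<m}. a \<otimes> e i) = (\<Oplus>i\<in>{..<m}. \<zero>)"
      by (intro finsum_cong') auto
    with ae[OF a(1)] \<open>a \<noteq> \<zero>\<close> show False by simp
  qed
  then obtain i where i: "i < m" and nz: "a \<otimes> e i \<noteq> \<zero>" by blast
  let ?x = "a \<otimes> e i"
  \<comment> \<open>Two decompositions of e_i: the products e_i e_j coming from e_i = e_i 1, and e_i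
    alone in position i. Uniqueness makes e_i idempotent.\<close>
  let ?y = "\<lambda>j\<in>{..<m}. e i \<otimes> e j" and ?z = "\<lambda>j\<in>{..<m}. if i = j then e j else \<zero>"
  have zero: "\<zero> \<in> I j" if "j < m" for j
    using left[OF that] additive_subgroup.zero_closed unfolding left_ideal_def by blast
  have "?y \<in> Pi\<^sub>E {..<m} I" "?z \<in> Pi\<^sub>E {..<m} I"
    using left ec[OF i] eI zero by (auto simp: left_ideal_def)
  moreover have "e i = (\<Oplus>j\<in>{..<m}. ?y j)"
    by (subst ae[OF ec[OF i]], rule finsum_cong') (use ec i in auto)
  moreover have "e i = (\<Oplus>j\<in>{..<m}. ?z j)"
    by (subst finsum_singleton[of i "{..<m}" e, symmetric], use ec i in auto, rule finsum_cong')
      (use ec i in auto)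
  ultimately have "?y = ?z" using dec[OF ec[OF i]] by (metis (no_types, lifting))
  from fun_cong[OF this, of i] have idem: "e i \<otimes> e i = e i" using i by simp
  have xI: "?x \<in> I i" using left[OF i] eI[OF i] a(1) by (simp add: left_ideal_def)
  have xc: "?x \<in> carrier R" using xI sub i by blast
  have "PIdl ?x \<subseteq> I i" using cgenideal_subset_left_ideal[OF left[OF i] xI] .
  moreover have "?x \<in> PIdl ?x" using cgenideal_self[OF xc] .
  ultimately have "PIdl ?x = I i"
    using simple[OF i] left_ideal_cgenideal[OF xc] nz unfolding simple_left_ideal_def by blast
  then obtain c where c: "c \<in> carrier R" "e i = c \<otimes> ?x"
    using eI[OF i] by (auto simp: cgenideal_def)
  have "e i = (c \<otimes> ?x) \<otimes> (c \<otimes> ?x)" using idem c(2) by simp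
  also have "\<dots> = (c \<otimes> c \<otimes> e i \<otimes> e i) \<otimes> (a \<otimes> a)"
    using c(1) a(1) ec[OF i] by (simp add: m_ac)
  also have "\<dots> = \<zero>" using a(2) c(1) ec[OF i] by simp
  finally show False using nz a(1) by simp
qed

section \<open>Orthogonal idempotents in regular rings\<close>

definition orthogonal_idempotents :: "nat \<Rightarrow> (nat \<Rightarrow> 'a) \<Rightarrow> bool" where
  "orthogonal_idempotents m e \<longleftrightarrow>
     (\<forall>i<m. e i \<in> carrier R \<and> e i \<noteq> \<zero>) \<and>
     (\<forall>i<m. \<forall>j<m. e i \<otimes> e j = (if i = j then e i else \<zero>))"

text \<open>The idempotents of a family are nonzero, so a bound on its length makes sense and a
  longest family exists. Maximality forces their sum to be 1 and forbids splitting any of them;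
  regularity puts a nonzero idempotent into every nonzero ideal, so each e_i generates a simple
  ideal.\<close>

lemma regular_imp_semisimple:
  assumes regular: "\<And>a. a \<in> carrier R \<Longrightarrow> \<exists>c\<in>carrier R. a = c \<otimes> a \<otimes> a"
    and bound: "\<And>m e. orthogonal_idempotents m e \<Longrightarrow> m \<le> N"
  shows "semisimple R"
proof -
  define Q where "Q m \<longleftrightarrow> (\<exists>e. orthogonal_idempotents m e)" for m
  have Q_bound: "\<And>m. Q m \<Longrightarrow> m \<le> N" using bound by (auto simp: Q_def)
  define m where "m = (GREATEST m. Q m)"
  \<comment> \<open>The empty family ensures that a greatest length exists.\<close>
  have "orthogonal_idempotents 0 (\<lambda>_. \<zero>)" by (simp add: orthogonal_idempotents_def)
  then have "Q 0" by (auto simp: Q_def intro: exI[of _ "\<lambda>_. \<zero>"])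
  then have "Q m" unfolding m_def using Q_bound by (rule GreatestI_nat)
  have "\<not> Q (Suc m)"
    using Greatest_le_nat[of Q "Suc m" N] Q_bound by (auto simp: m_def)
  then have max: "\<not> orthogonal_idempotents (Suc m) e" for e
    by (auto simp: Q_def)
  obtain e where e: "orthogonal_idempotents m e"
    using \<open>Q m\<close> unfolding Q_def by (elim exE)
  have ec: "e i \<in> carrier R" and enz: "e i \<noteq> \<zero>" if "i < m" for i
    using e that by (auto simp: orthogonal_idempotents_def)
  have ee: "e i \<otimes> e j = (if i = j then e i else \<zero>)" if "i < m" "j < m" for i j
    using e that by (auto simp: orthogonal_idempotents_def)
  define s where "s = (\<Oplus>i\<in>{..<m}. e i)"
  have sc: "s \<in> carrier R" unfolding s_def using ec by (intro finsum_closed) auto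
  have se: "s \<otimes> e i = e i" if "i < m" for i
  proof -
    have "s \<otimes> e i = (\<Oplus>j\<in>{..<m}. e j \<otimes> e i)"
      unfolding s_def using ec that by (intro finsum_ldistr) auto
    also have "\<dots> = (\<Oplus>j\<in>{..<m}. if i = j then e j else \<zero>)"
      using ee that ec by (intro finsum_cong') auto
    also have "\<dots> = e i"
      using finsum_singleton[of i "{..<m}" e] ec that by (auto simp: Pi_iff)
    finally show ?thesis .
  qed
  have ss: "s \<otimes> s = s"
  proof -
    have "s \<otimes> (\<Oplus>i\<in>{..<m}. e i) = (\<Oplus>i\<in>{..<m}. s \<otimes> e i)"
      using finsum_rdistr[of "{..<m}" s e] sc ec by (simp add: Pi_iff)
    also have "\<dots> = (\<Oplus>i\<in>{..<m}. e i)"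
      using se ec by (intro finsum_cong') auto
    finally show ?thesis by (simp only: s_def[symmetric])
  qed
  \<comment> \<open>Otherwise 1 - s is a further nonzero idempotent orthogonal to all e_i.\<close>
  have s1: "s = \<one>"
  proof (rule ccontr)
    assume "s \<noteq> \<one>"
    then have "\<one> \<ominus> s \<noteq> \<zero>" using sc by (metis one_closed r_right_minus_eq)
    moreover have "(\<one> \<ominus> s) \<otimes> (\<one> \<ominus> s) = \<one> \<ominus> s"
    proof -
      have "(\<one> \<ominus> s) \<otimes> (\<one> \<ominus> s) = \<one> \<ominus> s \<ominus> (s \<ominus> s \<otimes> s)" using sc by algebra
      then show ?thesis using ss sc by algebra
    qed
    moreover have "(\<one> \<ominus> s) \<otimes> e i = \<zero>" "e i \<otimes> (\<one> \<ominus> s) = \<zero>" if "i < m" for i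
    proof -
      have "(\<one> \<ominus> s) \<otimes> e i = e i \<ominus> s \<otimes> e i" using sc ec[OF that] by algebra
      then show "(\<one> \<ominus> s) \<otimes> e i = \<zero>" using se[OF that] ec[OF that] by algebra
      then show "e i \<otimes> (\<one> \<ominus> s) = \<zero>" using sc ec[OF that] by (simp add: m_comm)
    qed
    ultimately have "orthogonal_idempotents (Suc m) (e(m := \<one> \<ominus> s))"
      using e sc by (auto simp: orthogonal_idempotents_def less_Suc_eq)
    with max show False by blast
  qed
  have simple: "simple_left_ideal (PIdl (e i)) R" if i: "i < m" for i
    unfolding simple_left_ideal_def
  proof (intro conjI allI impI)
    show "left_ideal (PIdl (e i)) R" using left_ideal_cgenideal[OF ec[OF i]] .
    show "PIdl (e i) \<noteq> {\<zero>}" using cgenideal_self[OF ec[OF i]] enz[OF i] by blast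
    fix J assume J: "left_ideal J R \<and> J \<subseteq> PIdl (e i)"
    show "J = {\<zero>} \<or> J = PIdl (e i)"
    proof (cases "J \<subseteq> {\<zero>}")
      case True
      then show ?thesis
        using J additive_subgroup.zero_closed unfolding left_ideal_def by blast
    next
      case False
      then obtain a where a: "a \<in> J" "a \<noteq> \<zero>" by blast
      have ac: "a \<in> carrier R" using J a left_ideal_subset by blast
      obtain c where c: "c \<in> carrier R" "a = c \<otimes> a \<otimes> a" using regular[OF ac] by blast
      \<comment> \<open>From a = c a a it follows that u is idempotent and a = u a, so u is a
        nonzero idempotent of \<open>J\<close>.\<close>
      define u where "u = c \<otimes> a"
      have uc: "u \<in> carrier R" using c ac by (simp add: u_def)
      have uJ: "u \<in> J" using J a c by (simp add: left_ideal_def u_def)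
      have uu: "u \<otimes> u = u"
      proof -
        have "u \<otimes> u = c \<otimes> (c \<otimes> a \<otimes> a)" using c(1) ac by (simp add: u_def m_ac)
        then show ?thesis using c(2) by (simp add: u_def)
      qed
      have unz: "u \<noteq> \<zero>" using c a(2) ac by (auto simp: u_def)
      have "u \<in> PIdl (e i)" using J uJ by blast
      then obtain y where y: "y \<in> carrier R" "u = y \<otimes> e i" by (auto simp: cgenideal_def)
      have ue: "u \<otimes> e j = (if i = j then u else \<zero>)" if "j < m" for j
        using y ee[OF i that] ec i that by (auto simp: m_assoc)
      have eu: "e j \<otimes> u = (if i = j then u else \<zero>)" if "j < m" for j
        using ue[OF that] m_comm[OF uc ec[OF that]] by simp
      \<comment> \<open>Otherwise e_i is the sum of the nonzero orthogonal idempotents u and e_i -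
        u, and replacing it by these two gives a longer family.\<close>
      have "u = e i"
      proof (rule ccontr)
        assume "u \<noteq> e i"
        define v where "v = e i \<ominus> u"
        have eic: "e i \<in> carrier R" using ec[OF i] .
        have vc: "v \<in> carrier R" using uc eic by (simp add: v_def)
        have vnz: "v \<noteq> \<zero>" using \<open>u \<noteq> e i\<close> uc eic by (metis r_right_minus_eq v_def)
        have ev: "e j \<otimes> v = (if i = j then v else \<zero>)" if "j < m" for j
        proof -
          have "e j \<otimes> v = e j \<otimes> e i \<ominus> e j \<otimes> u"
            unfolding v_def using uc eic ec[OF that] by algebra
          then show ?thesis
            using ee[OF that i] eu[OF that] by (auto simp: v_def minus_eq)
        qed
        have uv: "u \<otimes> v = \<zero>"
        proof -
          have "u \<otimes> v = u \<otimes> e i \<ominus> u \<otimes> u" unfolding v_def using uc eic by algebra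
          then show ?thesis using ue[OF i] uu uc by (simp add: minus_eq r_neg)
        qed
        have vv: "v \<otimes> v = v"
        proof -
          have "v \<otimes> v = e i \<otimes> v \<ominus> u \<otimes> v" 
            by (subst (1) v_def) (use uc eic vc in algebra)
          then show ?thesis using ev[OF i] uv vc by (simp add: minus_eq)
        qed
        have comm: "v \<otimes> e j = e j \<otimes> v" if "j < m" for j
          using vc ec[OF that] m_comm by blast
        have "v \<otimes> u = \<zero>" using uv m_comm[OF uc vc] by simp
        then have "orthogonal_idempotents (Suc m) (e(i := u, m := v))"
          unfolding orthogonal_idempotents_def
          using i ec enz ee uc unz vc vnz ue eu ev uv vv uu comm
          by (auto simp: less_Suc_eq)
        with max show False by blast
      qed
      then have "PIdl (e i) \<subseteq> J"
        using cgenideal_subset_left_ideal[of J "e i"] J uJ by blast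
      then show ?thesis using J by blast
    qed
  qed
  have dec: "\<exists>!x. x \<in> Pi\<^sub>E {..<m} (\<lambda>i. PIdl (e i)) \<and> a = (\<Oplus>i\<in>{..<m}. x i)" if a: "a \<in> carrier R" for a
  proof (intro ex1I[of _ "\<lambda>i\<in>{..<m}. a \<otimes> e i"] conjI)
    show "(\<lambda>i\<in>{..<m}. a \<otimes> e i) \<in> Pi\<^sub>E {..<m} (\<lambda>i. PIdl (e i))"
      using a by (auto simp: cgenideal_def)
    have "a = (\<Oplus>i\<in>{..<m}. a \<otimes> e i)"
      using finsum_rdistr[of "{..<m}" a e] a ec s1 by (simp add: s_def Pi_iff)
    also have "\<dots> = (\<Oplus>i\<in>{..<m}. (\<lambda>i\<in>{..<m}. a \<otimes> e i) i)"
      using a ec by (intro finsum_cong') auto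
    finally show "a = (\<Oplus>i\<in>{..<m}. (\<lambda>i\<in>{..<m}. a \<otimes> e i) i)" .
  next
    fix x assume x: "x \<in> Pi\<^sub>E {..<m} (\<lambda>i. PIdl (e i)) \<and> a = (\<Oplus>i\<in>{..<m}. x i)"
    have xP: "x i \<in> PIdl (e i)" if "i < m" for i using x that by (auto simp: PiE_iff)
    have xc: "x i \<in> carrier R" if "i < m" for i
      using xP[OF that] ec[OF that] by (auto simp: cgenideal_def)
    have xe: "x j \<otimes> e i = (if i = j then x j else \<zero>)" if i: "i < m" and j: "j < m" for i j
    proof -
      obtain y where "y \<in> carrier R" "x j = y \<otimes> e j" using xP[OF j] by (auto simp: cgenideal_def)
      then show ?thesis using ee[OF j i] ec[OF i] ec[OF j] by (auto simp: m_assoc)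
    qed
    \<comment> \<open>Multiplication by e_i projects onto the i-th summand, so the components of
      \<open>a\<close> are determined by \<open>a\<close>.\<close>
    have "a \<otimes> e i = x i" if "i < m" for i
    proof -
      have "a \<otimes> e i = (\<Oplus>j\<in>{..<m}. x j \<otimes> e i)"
        using x xc ec that finsum_ldistr[of "{..<m}" "e i" x] by (auto simp: Pi_iff)
      also have "\<dots> = (\<Oplus>j\<in>{..<m}. if i = j then x j else \<zero>)"
        using xe that xc by (intro finsum_cong') auto
      also have "\<dots> = x i"
        using finsum_singleton[of i "{..<m}" x] xc that by (auto simp: Pi_iff)
      finally show ?thesis .
    qed
    then show "x = (\<lambda>i\<in>{..<m}. a \<otimes> e i)"
      using x by (intro extensionalityI[of _ "{..<m}"]) (auto simp: PiE_def)
  qed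
  show ?thesis
    unfolding semisimple_def
    by (intro conjI ring_axioms exI[of _ m] exI[of _ "\<lambda>i. PIdl (e i)"] allI impI ballI simple dec)
qed

text \<open>The exponent drops by one at a time: the square of a^(r+1) is a^(r+2) a^r.\<close>

lemma nat_pow_eq_zero_imp_eq_zero:
  assumes reduced: "\<And>a. a \<in> carrier R \<Longrightarrow> a \<otimes> a = \<zero> \<Longrightarrow> a = \<zero>"
    and a: "a \<in> carrier R" "a [^] (Suc r) = \<zero>"
  shows "a = \<zero>"
  using a(2)
proof (induction r)
  case 0
  then show ?case using a(1) by simp
next
  case (Suc r)
  have "a [^] (Suc r) \<otimes> a [^] (Suc r) = a [^] (Suc (Suc r)) \<otimes> a [^] r"
    using a(1) by (simp add: m_assoc m_comm m_lcomm)
  also have "\<dots> = \<zero>" using Suc.prems a(1) by (simp del: nat_pow_Suc)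
  finally show ?case using Suc.IH reduced[of "a [^] (Suc r)"] a(1) by (simp del: nat_pow_Suc)
qed

text \<open>From \<open>a\<^sup>r = c a\<^sup>r\<^sup>+\<^sup>1\<close> the element \<open>a (1 - c a)\<close> has vanishing \<open>(r + 1)\<close>-st power.\<close>

lemma reduced_imp_semisimple:
  assumes reduced: "\<And>a. a \<in> carrier R \<Longrightarrow> a \<otimes> a = \<zero> \<Longrightarrow> a = \<zero>"
    and powers: "\<And>a. a \<in> carrier R \<Longrightarrow> \<exists>c\<in>carrier R. \<exists>r::nat. a [^] r = c \<otimes> a [^] (Suc r)"
    and bound: "\<And>m e. orthogonal_idempotents m e \<Longrightarrow> m \<le> N"
  shows "semisimple R"
proof (rule regular_imp_semisimple[OF _ bound])
  fix a assume a: "a \<in> carrier R"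
  obtain c and r :: nat where c: "c \<in> carrier R" and r: "a [^] r = c \<otimes> a [^] (Suc r)"
    using powers[OF a] by blast
  let ?u = "\<one> \<ominus> c \<otimes> a"
  have u: "?u \<in> carrier R" using a c by simp
  have "(a \<otimes> ?u) [^] (Suc r) = a \<otimes> (?u \<otimes> a [^] r) \<otimes> ?u [^] r"
    using a u by (simp add: nat_pow_distrib m_ac)
  also have "?u \<otimes> a [^] r = a [^] r \<ominus> c \<otimes> (a [^] r \<otimes> a)"
    using a c nat_pow_closed[OF a, of r] by algebra
  also have "\<dots> = \<zero>" using r a c by (simp add: minus_eq r_neg)
  finally have "(a \<otimes> ?u) [^] (Suc r) = \<zero>" using a u by simp
  then have "a \<otimes> ?u = \<zero>"
    using nat_pow_eq_zero_imp_eq_zero[OF reduced, of "a \<otimes> ?u" r] a u by blast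
  moreover have "a \<otimes> ?u = a \<ominus> c \<otimes> a \<otimes> a" using a c by algebra
  ultimately have "a = c \<otimes> a \<otimes> a" using a c by (metis m_closed r_right_minus_eq)
  then show "\<exists>c\<in>carrier R. a = c \<otimes> a \<otimes> a" using c by blast
qed

end

section \<open>Matrices of square zero\<close>

lemma invertible_matI:
  fixes P :: "'k::field mat"
  assumes "P \<in> carrier_mat n n" "Q \<in> carrier_mat n n" "P * Q = 1\<^sub>m n"
  shows "invertible_mat P"
  using assms mat_mult_left_right_inverse[OF assms]
  unfolding invertible_mat_def inverts_mat_def by (auto simp: square_mat.simps)

lemma invertible_mat_obtain_inverse:
  fixes P :: "'k::field mat"
  assumes "P \<in> carrier_mat n n" "invertible_mat P"
  obtains Q where "Q \<in> carrier_mat n n" "P * Q = 1\<^sub>m n" "Q * P = 1\<^sub>m n"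
proof -
  obtain Q where Q: "P * Q = 1\<^sub>m n" "Q * P = 1\<^sub>m (dim_row Q)"
    using assms by (auto simp: invertible_mat_def inverts_mat_def)
  have "dim_col Q = n" using arg_cong[OF Q(1), of dim_col] by simp
  moreover have "dim_row Q = n" using arg_cong[OF Q(2), of dim_col] assms(1) by simp
  ultimately show ?thesis using that[of Q] Q by (metis carrier_matI)
qed

section \<open>Column vectors as functions on the indices\<close>

definition fun_scale :: "'k::field \<Rightarrow> (nat \<Rightarrow> 'k) \<Rightarrow> nat \<Rightarrow> 'k" where
  "fun_scale c v = (\<lambda>i. c * v i)"

interpretation fs: vector_space fun_scale
  by unfold_locales (auto simp: fun_scale_def algebra_simps fun_eq_iff)

lemma sum_fun_apply: "(\<Sum>x\<in>A. g x) i = (\<Sum>x\<in>A. g x i :: 'k::comm_monoid_add)"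
  by (induction A rule: infinite_finite_induct) (simp_all add: zero_fun_def)

text \<open>The space of columns of length \<open>n\<close>, as a subspace of all functions on
  \<open>nat\<close>: the locale \<open>vector_space\<close> takes a whole type as its vectors and
  supplies basis extension and dimension for subspaces.\<close>

definition fin_supp :: "nat \<Rightarrow> (nat \<Rightarrow> 'k::field) set" where
  "fin_supp n = {v. \<forall>i\<ge>n. v i = 0}"

definition unit_fun :: "nat \<Rightarrow> nat \<Rightarrow> 'k::field" where
  "unit_fun k = (\<lambda>i. if i = k then 1 else 0)"

lemma subspace_fin_supp: "fs.subspace (fin_supp n)"
  by (intro fs.subspaceI) (auto simp: fin_supp_def fun_scale_def)

lemma unit_fun_basis:
  shows "unit_fun ` {..<n} \<subseteq> (fin_supp n :: (nat \<Rightarrow> 'k::field) set)"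
    and "(fin_supp n :: (nat \<Rightarrow> 'k) set) \<subseteq> fs.span (unit_fun ` {..<n})"
    and "fs.independent (unit_fun ` {..<n} :: (nat \<Rightarrow> 'k::field) set)"
    and "card (unit_fun ` {..<n} :: (nat \<Rightarrow> 'k) set) = n"
proof -
  have inj: "inj_on (unit_fun :: nat \<Rightarrow> nat \<Rightarrow> 'k) {..<n}"
    by (intro inj_onI) (metis unit_fun_def zero_neq_one)
  show "card (unit_fun ` {..<n} :: (nat \<Rightarrow> 'k) set) = n"
    using inj by (simp add: card_image)
  show "unit_fun ` {..<n} \<subseteq> (fin_supp n :: (nat \<Rightarrow> 'k) set)"
    by (auto simp: fin_supp_def unit_fun_def)
  show "(fin_supp n :: (nat \<Rightarrow> 'k) set) \<subseteq> fs.span (unit_fun ` {..<n})"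
  proof
    fix v :: "nat \<Rightarrow> 'k" assume v: "v \<in> fin_supp n"
    have "v = (\<Sum>k<n. fun_scale (v k) (unit_fun k))"
    proof
      fix i
      show "v i = (\<Sum>k<n. fun_scale (v k) (unit_fun k)) i"
        using v by (cases "i < n")
          (auto simp: sum_fun_apply fun_scale_def unit_fun_def fin_supp_def if_distrib sum.delta' cong: if_cong)
    qed
    also have "\<dots> \<in> fs.span (unit_fun ` {..<n})"
      by (intro fs.span_sum fs.span_scale fs.span_base) auto
    finally show "v \<in> fs.span (unit_fun ` {..<n})" .
  qed
  show "fs.independent (unit_fun ` {..<n} :: (nat \<Rightarrow> 'k) set)"
  proof (rule fs.independent_if_scalars_zero)
    fix f :: "(nat \<Rightarrow> 'k) \<Rightarrow> 'k" and x :: "nat \<Rightarrow> 'k"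
    assume z: "(\<Sum>x\<in>unit_fun ` {..<n}. fun_scale (f x) x) = 0" and x: "x \<in> unit_fun ` {..<n}"
    obtain k where k: "k < n" "x = unit_fun k" using x by auto
    have "(\<Sum>j<n. fun_scale (f (unit_fun j)) (unit_fun j)) k = 0"
      using fun_cong[OF z, of k] inj by (simp add: sum.reindex zero_fun_def)
    then show "f x = 0"
      using k by (simp add: sum_fun_apply fun_scale_def unit_fun_def if_distrib sum.delta cong: if_cong)
  qed simp
qed

definition mat_fun :: "nat \<Rightarrow> 'k::field mat \<Rightarrow> (nat \<Rightarrow> 'k) \<Rightarrow> nat \<Rightarrow> 'k" where
  "mat_fun n X v = (\<lambda>i. if i < n then \<Sum>j<n. X $$ (i, j) * v j else 0)"

lemma mat_fun_mem: "mat_fun n X v \<in> fin_supp n"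
  by (simp add: mat_fun_def fin_supp_def)

lemma mat_fun_zero: "mat_fun n X 0 = 0"
  by (simp add: mat_fun_def fun_eq_iff)

lemma mat_fun_add: "mat_fun n X (u + v) = mat_fun n X u + mat_fun n X v"
  by (auto simp: mat_fun_def fun_eq_iff algebra_simps sum.distrib)

lemma mat_fun_diff: "mat_fun n X (u - v) = mat_fun n X u - mat_fun n X v"
  by (auto simp: mat_fun_def fun_eq_iff algebra_simps sum_subtractf)

lemma mat_fun_scale: "mat_fun n X (fun_scale c v) = fun_scale c (mat_fun n X v)"
  by (auto simp: mat_fun_def fun_eq_iff fun_scale_def sum_distrib_left algebra_simps)

lemma mat_fun_sum: "mat_fun n X (sum g A) = (\<Sum>x\<in>A. mat_fun n X (g x))"
  by (induction A rule: infinite_finite_induct)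
    (simp_all only: sum.infinite sum.empty sum.insert mat_fun_zero mat_fun_add not_False_eq_True)

lemma mat_fun_square:
  assumes X: "X \<in> carrier_mat n n" and sq: "X * X = 0\<^sub>m n n"
  shows "mat_fun n X (mat_fun n X v) = 0"
proof
  fix i
  have XX: "(\<Sum>j<n. X $$ (i, j) * X $$ (j, k)) = 0" if "i < n" "k < n" for k
  proof -
    have "(X * X) $$ (i, k) = (\<Sum>j<n. X $$ (i, j) * X $$ (j, k))"
      using X that by (simp add: scalar_prod_def lessThan_atLeast0)
    then show ?thesis using sq that by simp
  qed
  have "(\<Sum>j<n. X $$ (i, j) * (\<Sum>k<n. X $$ (j, k) * v k)) = 0" if "i < n"
  proof -
    have "(\<Sum>j<n. X $$ (i, j) * (\<Sum>k<n. X $$ (j, k) * v k)) =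
        (\<Sum>k<n. (\<Sum>j<n. X $$ (i, j) * X $$ (j, k)) * v k)"
      by (simp add: sum_distrib_left sum_distrib_right mult.assoc) (rule sum.swap)
    also have "\<dots> = 0" using XX[OF that] by simp
    finally show ?thesis .
  qed
  then show "mat_fun n X (mat_fun n X v) i = 0 i" by (simp add: mat_fun_def)
qed

text \<open>
  A basis of the image is extended to a basis of the kernel, and then by preimages of the former.
\<close>

lemma square_zero_mat_normal_form:
  fixes X :: "'k::field mat"
  assumes X: "X \<in> carrier_mat n n" and sq: "X * X = 0\<^sub>m n n" and nz: "X \<noteq> 0\<^sub>m n n"
  obtains P l where "P \<in> carrier_mat n n" "invertible_mat P" "1 \<le> l" "2 * l \<le> n"
    "\<And>i. i < l \<Longrightarrow> X *\<^sub>v col P (l + i) = col P i"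
    "\<And>j. j < n \<Longrightarrow> \<not> (l \<le> j \<and> j < 2 * l) \<Longrightarrow> X *\<^sub>v col P j = 0\<^sub>v n"
proof -
  let ?F = "mat_fun n X" and ?V = "fin_supp n :: (nat \<Rightarrow> 'k) set"
  let ?E = "unit_fun ` {..<n} :: (nat \<Rightarrow> 'k) set"
  define K where "K = {v \<in> ?V. ?F v = 0}"
  obtain B1 where B1: "B1 \<subseteq> ?F ` ?V" "fs.independent B1" "?F ` ?V \<subseteq> fs.span B1"
    using fs.maximal_independent_subset by metis
  have "?F ` ?V \<subseteq> K" by (auto simp: K_def mat_fun_mem mat_fun_square[OF X sq])
  then have "B1 \<subseteq> K" using B1(1) by blast
  then obtain B2 where B2: "B1 \<subseteq> B2" "B2 \<subseteq> K" "fs.independent B2" "K \<subseteq> fs.span B2"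
    using fs.maximal_independent_subset_extend[OF _ B1(2)] by metis
  have "B2 \<subseteq> fs.span ?E" using B2(2) unit_fun_basis(2)[of n] by (auto simp: K_def)
  then have fin2: "finite B2"
    using fs.independent_span_bound[OF _ B2(3), of ?E] by simp
  then have fin1: "finite B1" using B2(1) finite_subset by blast
  have "\<forall>b\<in>B1. \<exists>v. v \<in> ?V \<and> ?F v = b" using B1(1) by blast
  then obtain w where w: "\<And>b. b \<in> B1 \<Longrightarrow> w b \<in> ?V" "\<And>b. b \<in> B1 \<Longrightarrow> ?F (w b) = b"
    by metis
  have winj: "inj_on w B1" using w(2) by (metis inj_onI)
  \<comment> \<open>A preimage \<open>w b\<close> inside the kernel would force b = 0, which
    independence of \<open>B1\<close> excludes.\<close>
  have disj: "w ` B1 \<inter> B2 = {}"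
  proof -
    have "?F (w b) = 0" if "w b \<in> B2" for b using that B2(2) by (auto simp: K_def)
    moreover have "0 \<notin> B1" using B1(2) fs.dependent_zero by blast
    ultimately show ?thesis using w(2) by force
  qed
  define B where "B = w ` B1 \<union> B2"
  have finB: "finite B" using fin1 fin2 by (simp add: B_def)
  have BV: "B \<subseteq> ?V" using w(1) B2(2) by (auto simp: B_def K_def)
  \<comment> \<open>Applying X to a relation kills the part in \<open>B2\<close> and leaves a
    relation among the elements of \<open>B1\<close>; what remains afterwards is a relation inside
    \<open>B2\<close>.\<close>
  have indep: "fs.independent B"
  proof (rule fs.independent_if_scalars_zero[OF finB])
    fix f x assume z: "(\<Sum>x\<in>B. fun_scale (f x) x) = 0" and x: "x \<in> B"
    have split: "(\<Sum>x\<in>B. fun_scale (f x) x) =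
        (\<Sum>b\<in>B1. fun_scale (f (w b)) (w b)) + (\<Sum>x\<in>B2. fun_scale (f x) x)"
      unfolding B_def using fin1 fin2 disj winj by (simp add: sum.union_disjoint sum.reindex)
    have "(\<Sum>b\<in>B1. ?F (fun_scale (f (w b)) (w b))) + (\<Sum>x\<in>B2. ?F (fun_scale (f x) x)) = 0"
      using z by (simp add: split mat_fun_add[symmetric] mat_fun_sum[symmetric] mat_fun_zero)
    moreover have "(\<Sum>x\<in>B2. ?F (fun_scale (f x) x)) = 0"
      using B2(2) by (intro sum.neutral) (auto simp: mat_fun_scale K_def)
    moreover have "(\<Sum>b\<in>B1. ?F (fun_scale (f (w b)) (w b))) = (\<Sum>b\<in>B1. fun_scale (f (w b)) b)"
      using w(2) by (intro sum.cong) (auto simp: mat_fun_scale)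
    ultimately have "(\<Sum>b\<in>B1. fun_scale (f (w b)) b) = 0" by simp
    then have f1: "f (w b) = 0" if "b \<in> B1" for b
      using fs.independentD[OF B1(2) fin1 subset_refl, of "\<lambda>b. f (w b)"] that by simp
    then have "(\<Sum>x\<in>B2. fun_scale (f x) x) = 0" using z by (simp add: split)
    then have "f x = 0" if "x \<in> B2"
      using fs.independentD[OF B2(3) fin2 subset_refl, of f] that by simp
    then show "f x = 0" using f1 x by (auto simp: B_def)
  qed
  \<comment> \<open>Subtracting the chosen preimage of \<open>?F v\<close> from v leaves an element
    of the kernel.\<close>
  have span: "?V \<subseteq> fs.span B"
  proof
    fix v assume v: "v \<in> ?V"
    then have "?F v \<in> fs.span B1" using B1(3) by blast
    then obtain c where c: "?F v = (\<Sum>b\<in>B1. fun_scale (c b) b)"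
      using fs.span_finite[OF fin1] by auto
    let ?u = "\<Sum>b\<in>B1. fun_scale (c b) (w b)"
    have "?F ?u = ?F v" unfolding c mat_fun_sum
      using w(2) by (intro sum.cong) (auto simp: mat_fun_scale)
    moreover have "?u \<in> ?V"
      using w(1) by (intro fs.subspace_sum fs.subspace_scale subspace_fin_supp)
    ultimately have "v - ?u \<in> K"
      using v fs.subspace_diff[OF subspace_fin_supp] by (simp add: K_def mat_fun_diff)
    then have "v - ?u \<in> fs.span B"
      using B2(4) fs.span_mono[of B2 B] by (auto simp: B_def)
    moreover have "?u \<in> fs.span B"
      by (intro fs.span_sum fs.span_scale fs.span_base) (auto simp: B_def)
    ultimately show "v \<in> fs.span B" using fs.span_add by fastforce
  qed
  define l where "l = card B1"
  have cardB: "card B = n"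
    using fs.basis_card_eq_dim[OF BV span indep]
      fs.basis_card_eq_dim[OF unit_fun_basis(1,2,3)[of n, where 'k = 'k]]
      unit_fun_basis(4)[of n, where 'k = 'k] by simp
  have card_split: "card B = l + card B2"
    unfolding B_def l_def using fin1 fin2 disj winj by (simp add: card_Un_disjoint card_image)
  \<comment> \<open>Since n = l + |B2| and \<open>B1\<close> is a subset of \<open>B2\<close> with l
    elements, both claims are a count.\<close>
  have card2: "card (B2 - B1) = n - 2 * l" and l2: "2 * l \<le> n"
    using card_split cardB card_Diff_subset[OF fin1 B2(1)] card_mono[OF fin2 B2(1)]
    by (auto simp: l_def)
  have l1: "1 \<le> l"
  proof (rule ccontr)
    assume "\<not> 1 \<le> l"
    then have "B1 = {}" using fin1 by (simp add: l_def not_le)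
    then have F0: "?F v = 0" if "v \<in> ?V" for v using B1(3) that by auto
    have "X $$ (i, j) = 0" if "i < n" "j < n" for i j
    proof -
      have "unit_fun j \<in> ?V" using unit_fun_basis(1)[of n] that by auto
      from F0[OF this] have "?F (unit_fun j) i = 0" by (simp add: zero_fun_def)
      then show ?thesis
        using that by (simp add: mat_fun_def unit_fun_def if_distrib sum.delta' cong: if_cong)
    qed
    then show False using nz X by (metis eq_matI carrier_matD index_zero_mat)
  qed
  obtain b1 where b1: "bij_betw b1 {0..<l} B1"
    using ex_bij_betw_nat_finite[OF fin1] by (auto simp: l_def)
  obtain b3 where b3: "bij_betw b3 {0..<n - 2 * l} (B2 - B1)"
    using ex_bij_betw_nat_finite[of "B2 - B1"] fin2 card2 by auto
  \<comment> \<open>Basis order: the image first, then the preimages in matching order, then the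
    rest of the kernel.\<close>
  define p where "p j = (if j < l then b1 j else if j < 2 * l then w (b1 (j - l)) else b3 (j - 2 * l))" for j
  have b1_mem: "b1 j \<in> B1" if "j < l" for j using b1 that by (auto simp: bij_betw_def)
  have b3_mem: "b3 j \<in> B2" if "j < n - 2 * l" for j using b3 that by (auto simp: bij_betw_def)
  have "B \<subseteq> p ` {..<n}"
  proof
    fix x assume "x \<in> B"
    then consider "x \<in> w ` B1" | "x \<in> B1" | "x \<in> B2 - B1" by (auto simp: B_def)
    then show "x \<in> p ` {..<n}"
    proof cases
      case 1
      then obtain j where "j < l" "x = w (b1 j)" using b1 by (auto simp: bij_betw_def)
      then have "x = p (l + j)" "l + j < n" using l2 by (auto simp: p_def)
      then show ?thesis by blast
    next
      case 2
      then obtain j where "j < l" "x = b1 j" using b1 by (auto simp: bij_betw_def)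
      then have "x = p j" "j < n" using l2 by (auto simp: p_def)
      then show ?thesis by blast
    next
      case 3
      then obtain j where "j < n - 2 * l" "x = b3 j"
        using b3 unfolding bij_betw_def by (metis atLeastLessThan_iff imageE)
      then have "x = p (2 * l + j)" "2 * l + j < n" by (auto simp: p_def)
      then show ?thesis by blast
    qed
  qed
  then have pB: "p ` {..<n} = B"
    using card_seteq[of "p ` {..<n}" B] card_image_le[of "{..<n}" p] cardB by simp
  then have pinj: "inj_on p {..<n}" using cardB by (intro eq_card_imp_inj_on) auto
  have "\<exists>c. unit_fun k = (\<Sum>j<n. fun_scale (c j) (p j))" if "k < n" for k
  proof -
    have "unit_fun k \<in> fs.span B" using span unit_fun_basis(1)[of n] that by auto
    then obtain c where "unit_fun k = (\<Sum>b\<in>B. fun_scale (c b) b)"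
      using fs.span_finite[OF finB] by auto
    then have "unit_fun k = (\<Sum>j<n. fun_scale (c (p j)) (p j))"
      using pinj by (simp add: pB[symmetric] sum.reindex)
    then show ?thesis by (rule exI[of _ "\<lambda>j. c (p j)"])
  qed
  then obtain c where c: "\<And>k. k < n \<Longrightarrow> unit_fun k = (\<Sum>j<n. fun_scale (c k j) (p j))"
    by metis
  define P where "P = mat n n (\<lambda>(i, j). p j i)"
  have Pc: "P \<in> carrier_mat n n" by (simp add: P_def)
  \<comment> \<open>The second factor lists the coordinates of the unit vectors in the new basis, a
    right inverse of P.\<close>
  have "P * mat n n (\<lambda>(j, k). c k j) = 1\<^sub>m n"
  proof (rule eq_matI)
    fix i k assume "i < dim_row (1\<^sub>m n)" "k < dim_col (1\<^sub>m n)"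
    then have ik: "i < n" "k < n" by simp_all
    have "(\<Sum>j<n. c k j * p j i) = unit_fun k i"
      using c[OF ik(2)] by (simp add: sum_fun_apply fun_scale_def)
    then show "(P * mat n n (\<lambda>(j, k). c k j)) $$ (i, k) = 1\<^sub>m n $$ (i, k)"
      using ik by (simp add: P_def scalar_prod_def lessThan_atLeast0 unit_fun_def mult.commute)
  qed (simp_all add: P_def)
  then have inv: "invertible_mat P" by (intro invertible_matI[OF Pc]) auto
  have act: "X *\<^sub>v col P j = vec n (?F (p j))" if "j < n" for j
    using X that by (intro eq_vecI) (auto simp: P_def mat_fun_def scalar_prod_def lessThan_atLeast0)
  have act1: "X *\<^sub>v col P (l + i) = col P i" if i: "i < l" for i
  proof -
    have "?F (p (l + i)) = p i" using i w(2) b1_mem by (simp add: p_def)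
    then show "X *\<^sub>v col P (l + i) = col P i"
      using act[of "l + i"] i l2 by (intro eq_vecI) (auto simp: P_def)
  qed
  have act2: "X *\<^sub>v col P j = 0\<^sub>v n" if j: "j < n" "\<not> (l \<le> j \<and> j < 2 * l)" for j
  proof -
    have "p j \<in> B2"
      using j b1_mem[of j] b3_mem[of "j - 2 * l"] B2(1) by (auto simp: p_def)
    then have "?F (p j) = 0" using B2(2) by (auto simp: K_def)
    then show "X *\<^sub>v col P j = 0\<^sub>v n" using act[OF j(1)] by (intro eq_vecI) auto
  qed
  show ?thesis using that[OF Pc inv l1 l2 act1 act2] by blast
qed

section \<open>Directional derivatives and the center\<close>

text \<open>The operator D(a) of the overview. Being free of coordinates, it turns conditions on
  matrix entries into conditions on vectors, which pass easily to another basis.\<close>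

definition dderiv :: "'k::comm_ring_1 vec \<Rightarrow> 'k mpoly \<Rightarrow> 'k mpoly" where
  "dderiv a p = (\<Sum>i<dim_vec a. mconst (a $ i) * mpderiv i p)"

lemma dderiv_zero_vec [simp]: "dderiv (0\<^sub>v n) p = 0"
  by (simp add: dderiv_def)

lemma dderiv_add_vec:
  "a \<in> carrier_vec n \<Longrightarrow> b \<in> carrier_vec n \<Longrightarrow> dderiv (a + b) p = dderiv a p + dderiv b p"
  by (auto simp: dderiv_def mconst_add distrib_right sum.distrib)

lemma dderiv_smult_vec: "dderiv (c \<cdot>\<^sub>v a) p = mconst c * dderiv a p"
  by (simp add: dderiv_def mconst_mult sum_distrib_left mult.assoc)

lemma dderiv_sum: "dderiv a (sum g A) = (\<Sum>x\<in>A. dderiv a (g x))"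
  by (simp add: dderiv_def mpderiv_sum sum_distrib_left) (rule sum.swap)

lemma dderiv_mconst_mult: "dderiv a (mconst c * p) = mconst c * dderiv a p"
  by (simp add: dderiv_def sum_distrib_left mult.left_commute)

lemma mpderiv_dderiv: "mpderiv i (dderiv a p) = dderiv a (mpderiv i p)"
  by (simp add: dderiv_def mpderiv_sum mpderiv_commute[of i])

lemma dderiv_commute: "dderiv a (dderiv b p) = dderiv b (dderiv a p)"
  unfolding dderiv_def[of b] by (simp add: dderiv_sum dderiv_mconst_mult mpderiv_dderiv)

lemma dderiv_unit_vec: "i < n \<Longrightarrow> dderiv (unit_vec n i) p = mpderiv i p"
proof -
  assume i: "i < n"
  have "dderiv (unit_vec n i) p = (\<Sum>j<n. if i = j then mpderiv j p else 0)"
    unfolding dderiv_def using i by (intro sum.cong) auto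
  then show ?thesis using i by simp
qed

lemma mult_mat_unit_vec:
  "X \<in> carrier_mat m n \<Longrightarrow> j < n \<Longrightarrow> X *\<^sub>v unit_vec n j = col (X :: 'a::semiring_1 mat) j"
  by (intro eq_vecI) auto

lemma dderiv_mult_mat_vec:
  assumes "X \<in> carrier_mat n n" "a \<in> carrier_vec n"
  shows "dderiv (X *\<^sub>v a) p = (\<Sum>j<n. mconst (a $ j) * dderiv (col X j) p)"
proof -
  have "dderiv (X *\<^sub>v a) p = (\<Sum>i<n. \<Sum>j<n. mconst (a $ j) * (mconst (X $$ (i, j)) * mpderiv i p))"
    unfolding dderiv_def using assms
    by (intro sum.cong)
      (auto simp: scalar_prod_def lessThan_atLeast0 mconst_sum mconst_mult sum_distrib_left mult_ac)
  also have "\<dots> = (\<Sum>j<n. \<Sum>i<n. mconst (a $ j) * (mconst (X $$ (i, j)) * mpderiv i p))"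
    by (rule sum.swap)
  also have "\<dots> = (\<Sum>j<n. mconst (a $ j) * dderiv (col X j) p)"
    using assms by (intro sum.cong) (auto simp: dderiv_def sum_distrib_left)
  finally show ?thesis .
qed

section \<open>Forms under linear changes of variables\<close>

lemma mvars_sum: "(\<And>x. x \<in> A \<Longrightarrow> mvars (g x) \<subseteq> V) \<Longrightarrow> mvars (sum g A) \<subseteq> V"
proof (induction A rule: infinite_finite_induct)
  case (insert x F)
  then show ?case using mvars_add[of "g x" "sum g F"] by auto
qed simp_all

lemma mvars_minus: "mvars (p - q) \<subseteq> mvars p \<union> mvars q"
proof -
  have "Poly_Mapping.keys (p - q) \<subseteq> Poly_Mapping.keys p \<union> Poly_Mapping.keys q"
    by (auto simp: in_keys_iff lookup_minus)
  then show ?thesis unfolding mvars_def by blast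
qed

lemma is_form_add: "is_form d n p \<Longrightarrow> is_form d n q \<Longrightarrow> is_form d n (p + q)"
  using mvars_add[of p q] homogeneous_add[of d p q] by (auto simp: is_form_iff)

lemma is_form_sum: "(\<And>x. x \<in> A \<Longrightarrow> is_form d n (g x)) \<Longrightarrow> is_form d n (sum g A)"
  by (induction A rule: infinite_finite_induct) (simp_all add: is_form_add, simp_all add: is_form_iff)

lemma homogeneous_mconst_mult: "homogeneous d p \<Longrightarrow> homogeneous d (mconst c * p)"
  using homogeneous_mult[OF homogeneous_mconst, of d p c] by simp

lemma homogeneous_mvar_mult: "homogeneous (d - 1) p \<Longrightarrow> 0 < d \<Longrightarrow> homogeneous d (mvar i * p)"
  using homogeneous_mult[OF homogeneous_mvar, of "d - 1" p i] by simp

lemma mvars_mconst_mult: "mvars (mconst c * p) \<subseteq> mvars p"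
  using mvars_mult[of "mconst c" p] by simp

lemma is_form_dderiv: "is_form d n p \<Longrightarrow> is_form (d - 1) n (dderiv a p)"
  unfolding dderiv_def
proof (intro is_form_sum)
  fix i assume "is_form d n p"
  from is_form_mpderiv[OF this, of i]
  show "is_form (d - 1) n (mconst (a $ i) * mpderiv i p)"
    using homogeneous_mconst_mult mvars_mconst_mult[of "a $ i" "mpderiv i p"]
    by (auto simp: is_form_iff)
qed

lemma mvars_dderiv: "mvars (dderiv a p) \<subseteq> mvars p"
  unfolding dderiv_def
proof (intro mvars_sum)
  fix i show "mvars (mconst (a $ i) * mpderiv i p) \<subseteq> mvars p"
    using mvars_mconst_mult[of "a $ i" "mpderiv i p"] mvars_mpderiv[of i p] by blast
qed

lemma lin_subst_zero [simp]: "lin_subst n P 0 = 0"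
  by (simp add: lin_subst_def)

lemma is_form_lin_subst:
  assumes "is_form d n p"
  shows "is_form d n (lin_subst n P p)"
proof -
  have "homogeneous 1 (mconst (P $$ (i, j)) * mvar j)" for i j
    by (intro homogeneous_mconst_mult homogeneous_mvar)
  moreover have "mvars (mconst (P $$ (i, j)) * mvar j) \<subseteq> {..<n}" if "j < n" for i j
    using mvars_mconst_mult[of "P $$ (i, j)" "mvar j"] that by auto
  ultimately show ?thesis
    using assms unfolding is_form_iff lin_subst_def
    by (intro conjI homogeneous_msubst mvars_msubst homogeneous_sum mvars_sum) auto
qed

text \<open>The j-th derivative of the i-th substituted linear form is the entry (i, j) of
  \<open>P\<close>, so by the chain rule deriving along the j-th axis means deriving
  \<open>p\<close> along column j of \<open>P\<close>; the rest is linearity in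
  \<open>a\<close>.\<close>

lemma dderiv_lin_subst:
  assumes P: "P \<in> carrier_mat n n" and p: "mvars p \<subseteq> {..<n}" and a: "a \<in> carrier_vec n"
  shows "dderiv a (lin_subst n P p) = lin_subst n P (dderiv (P *\<^sub>v a) p)"
proof -
  have coord: "mpderiv j (\<Sum>k<n. mconst (P $$ (i, k)) * mvar k) = mconst (P $$ (i, j))"
    if "j < n" for i j
    using that by (simp add: mpderiv_sum mpderiv_mvar if_distrib sum.delta' cong: if_cong)
  have "mpderiv j (lin_subst n P p) = (\<Sum>i<n. lin_subst n P (mpderiv i p) * mconst (P $$ (i, j)))"
    if "j < n" for j
    unfolding lin_subst_def mpderiv_msubst[OF p finite_lessThan] using coord[OF that] by simp
  then have "mpderiv j (lin_subst n P p) = lin_subst n P (dderiv (col P j) p)" if "j < n" for j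
    using that P by (simp add: dderiv_def lin_subst_def msubst_sum msubst_mult mult.commute)
  then have "dderiv a (lin_subst n P p) =
      (\<Sum>j<n. mconst (a $ j) * lin_subst n P (dderiv (col P j) p))"
    using a by (simp add: dderiv_def[of a])
  also have "\<dots> = lin_subst n P (dderiv (P *\<^sub>v a) p)"
    unfolding dderiv_mult_mat_vec[OF P a] by (simp add: lin_subst_def msubst_sum msubst_mult)
  finally show ?thesis .
qed

text \<open>Substituting by \<open>P\<close> first and by \<open>Q\<close> second yields p(PQx),
  which explains the order of the product.\<close>

lemma lin_subst_inverse:
  assumes P: "P \<in> carrier_mat n n" and Q: "Q \<in> carrier_mat n n" and PQ: "P * Q = 1\<^sub>m n"
    and p: "mvars p \<subseteq> {..<n}"
  shows "lin_subst n Q (lin_subst n P p) = p"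
proof -
  have "lin_subst n Q (lin_subst n P p) =
      msubst (\<lambda>i. \<Sum>j<n. mconst (P $$ (i, j)) * (\<Sum>k<n. mconst (Q $$ (j, k)) * mvar k)) p"
    by (simp add: lin_subst_def msubst_msubst msubst_sum msubst_mult)
  also have "\<dots> = msubst mvar p"
  proof (rule msubst_cong)
    fix i assume "i \<in> mvars p"
    then have i: "i < n" using p by auto
    have "(\<Sum>j<n. mconst (P $$ (i, j)) * (\<Sum>k<n. mconst (Q $$ (j, k)) * mvar k)) =
        (\<Sum>k<n. \<Sum>j<n. mconst (P $$ (i, j) * Q $$ (j, k)) * mvar k)"
      by (simp add: sum_distrib_left mconst_mult mult.assoc) (rule sum.swap)
    also have "\<dots> = (\<Sum>k<n. mconst ((P * Q) $$ (i, k)) * mvar k)"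
      using P Q i by (intro sum.cong)
        (auto simp: scalar_prod_def lessThan_atLeast0 mconst_sum sum_distrib_right)
    also have "\<dots> = (\<Sum>k<n. if i = k then mvar k else 0)"
      using i by (intro sum.cong) (auto simp: PQ)
    also have "\<dots> = mvar i" using i by simp
    finally show "(\<Sum>j<n. mconst (P $$ (i, j)) * (\<Sum>k<n. mconst (Q $$ (j, k)) * mvar k)) = mvar i" .
  qed
  finally show ?thesis by (simp add: msubst_ident)
qed

lemma mvars_shift_vars: "mvars p \<subseteq> {..<k} \<Longrightarrow> mvars (shift_vars l p) \<subseteq> {l..<l + k}"
  unfolding shift_vars_def by (intro mvars_msubst) auto

text \<open>The shift is undone by i - l; truncation does no harm because every variable of
  \<open>q\<close> has index at least l.\<close>

lemma obtain_shift_vars: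
  assumes "homogeneous d q" "mvars q \<subseteq> {l..<l + k}"
  obtains p where "is_form d k p" "shift_vars l p = q"
proof
  let ?p = "msubst (\<lambda>i. mvar (i - l)) q"
  show "is_form d k ?p"
    unfolding is_form_iff
  proof (intro conjI homogeneous_msubst mvars_msubst homogeneous_mvar assms(1))
    fix i assume "i \<in> mvars q"
    with assms(2) have "i \<in> {l..<l + k}" by blast
    then show "mvars (mvar (i - l) :: 'a mpoly) \<subseteq> {..<k}" by auto
  qed
  have "shift_vars l ?p = msubst mvar q"
    unfolding shift_vars_def msubst_msubst using assms by (intro msubst_cong) auto
  then show "shift_vars l ?p = q" by (simp add: msubst_ident)
qed

text \<open>A nonzero direction of vanishing derivative can be made a coordinate axis, and then its
  variable disappears from the form.\<close>

lemma nondegenerate_dderiv: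
  fixes f :: "'k::field mpoly"
  assumes "nondegenerate n f" "mvars f \<subseteq> {..<n}" "c \<in> carrier_vec n" "dderiv c f = 0"
    and char: "CHAR('k) = 0 \<or> CHAR('k) > d" and f: "is_form d n f"
  shows "c = 0\<^sub>v n"
proof (rule ccontr)
  assume "c \<noteq> 0\<^sub>v n"
  then obtain p where p: "p < n" "c $ p \<noteq> 0"
    using assms(3) by (metis carrier_vecD eq_vecI index_zero_vec(1,2))
  \<comment> \<open>The identity matrix with column p replaced by c, invertible because c has a
    nonzero entry at p; \<open>Q\<close> is its explicit inverse.\<close>
  define P where "P = mat n n (\<lambda>(i, j). if j = p then c $ i else if i = j then 1 else 0)"
  define Q where "Q = mat n n (\<lambda>(i, j). if j = p then (if i = p then inverse (c $ p)
      else - c $ i * inverse (c $ p)) else if i = j then 1 else 0)"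
  have Pc: "P \<in> carrier_mat n n" and Qc: "Q \<in> carrier_mat n n" by (auto simp: P_def Q_def)
  have "P * Q = 1\<^sub>m n"
  proof (rule eq_matI)
    fix i k assume "i < dim_row (1\<^sub>m n)" "k < dim_col (1\<^sub>m n)"
    then have ik: "i < n" "k < n" by simp_all
    have "(P * Q) $$ (i, k) = (\<Sum>j<n. P $$ (i, j) * Q $$ (j, k))"
      using ik Pc Qc by (simp add: scalar_prod_def lessThan_atLeast0)
    also have "\<dots> = (\<Sum>j<n. (if j = p then c $ i * Q $$ (p, k) else 0) +
        (if j = i then (if i = p then 0 else Q $$ (i, k)) else 0))"
      using ik p(1) by (intro sum.cong) (auto simp: P_def)
    also have "\<dots> = c $ i * Q $$ (p, k) + (if i = p then 0 else Q $$ (i, k))"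
      using ik p(1) by (simp add: sum.distrib sum.delta)
    also have "\<dots> = 1\<^sub>m n $$ (i, k)"
      using ik p by (auto simp: Q_def)
    finally show "(P * Q) $$ (i, k) = 1\<^sub>m n $$ (i, k)" .
  qed (simp_all add: P_def Q_def)
  then have "invertible_mat P" using invertible_matI[OF Pc Qc] by blast
  then have "p \<in> mvars (lin_subst n P f)" using assms(1) Pc p(1) by (simp add: nondegenerate_def)
  moreover have "P *\<^sub>v unit_vec n p = c"
    using p assms(3) Pc by (intro eq_vecI) (auto simp: P_def)
  then have "mpderiv p (lin_subst n P f) = 0"
    using dderiv_lin_subst[OF Pc assms(2) unit_vec_carrier[of n p]] assms(4) p(1)
    by (simp add: dderiv_unit_vec)
  then have "p \<notin> mvars (lin_subst n P f)"
    using is_form_lin_subst[OF f, of P]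
    by (intro notin_mvars_of_mpderiv_eq_0[OF char]) (auto simp: is_form_iff)
  ultimately show False by blast
qed

section \<open>The center as the set of self-adjoint matrices\<close>

lemma center_iff_col:
  "X \<in> center n f \<longleftrightarrow> X \<in> carrier_mat n n \<and>
     (\<forall>i<n. \<forall>j<n. mpderiv i (dderiv (col X j) f) = mpderiv j (dderiv (col X i) f))"
proof -
  \<comment> \<open>Column j of the product combines the columns of the Hessian with the entries of
    column j of X, and these constants pass through the derivative.\<close>
  have entry: "(hessian n f * map_mat mconst X) $$ (i, j) = mpderiv i (dderiv (col X j) f)"
    if "X \<in> carrier_mat n n" "i < n" "j < n" for i j
    using that by (simp add: hessian_def scalar_prod_def lessThan_atLeast0 dderiv_def mpderiv_sum mpderiv_mult mult.commute)
  have dim: "dim_row (hessian n f * map_mat mconst X) = n"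
    "dim_col (hessian n f * map_mat mconst X) = n" if "X \<in> carrier_mat n n"
    using that by (auto simp: hessian_def)
  have "transpose_mat M = M \<longleftrightarrow> (\<forall>i<n. \<forall>j<n. M $$ (i, j) = M $$ (j, i))"
    if "dim_row M = n" "dim_col M = n" for M :: "'a mpoly mat"
    using that by (auto simp: mat_eq_iff)
  from this[OF dim]
  have "transpose_mat (hessian n f * map_mat mconst X) = hessian n f * map_mat mconst X \<longleftrightarrow>
      (\<forall>i<n. \<forall>j<n. mpderiv i (dderiv (col X j) f) = mpderiv j (dderiv (col X i) f))"
    if "X \<in> carrier_mat n n"
    using that by (simp only: entry cong: imp_cong)
  then show ?thesis unfolding center_def by blast
qed

text \<open>The symmetry on unit vectors extends to all vectors by bilinearity.\<close>

lemma center_iff: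
  "X \<in> center n f \<longleftrightarrow> X \<in> carrier_mat n n \<and>
     (\<forall>a\<in>carrier_vec n. \<forall>b\<in>carrier_vec n.
        dderiv (X *\<^sub>v a) (dderiv b f) = dderiv a (dderiv (X *\<^sub>v b) f))"
proof (cases "X \<in> carrier_mat n n")
  case X: True
  show ?thesis
  proof
    assume "X \<in> center n f"
    then have sym: "mpderiv i (dderiv (col X j) f) = mpderiv j (dderiv (col X i) f)"
      if "i < n" "j < n" for i j
      using that by (simp add: center_iff_col)
    have "dderiv (X *\<^sub>v a) (dderiv b f) = dderiv a (dderiv (X *\<^sub>v b) f)"
      if a: "a \<in> carrier_vec n" and b: "b \<in> carrier_vec n" for a b
    proof -
      have "dderiv (X *\<^sub>v a) (dderiv b f) =
          (\<Sum>j<n. \<Sum>i<n. mconst (a $ j) * (mconst (b $ i) * mpderiv i (dderiv (col X j) f)))"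
        using b unfolding dderiv_commute[of _ b] dderiv_mult_mat_vec[OF X a] dderiv_sum
        by (simp add: dderiv_def[of b] sum_distrib_left mult.left_commute)
      also have "\<dots> = (\<Sum>j<n. \<Sum>i<n. mconst (a $ j) * (mconst (b $ i) * mpderiv j (dderiv (col X i) f)))"
        by (intro sum.cong refl) (simp add: sym)
      also have "\<dots> = dderiv a (dderiv (X *\<^sub>v b) f)"
        using a by (simp add: dderiv_mult_mat_vec[OF X b] dderiv_def[of a] mpderiv_sum sum_distrib_left)
      finally show ?thesis .
    qed
    then show "X \<in> carrier_mat n n \<and> (\<forall>a\<in>carrier_vec n. \<forall>b\<in>carrier_vec n.
        dderiv (X *\<^sub>v a) (dderiv b f) = dderiv a (dderiv (X *\<^sub>v b) f))"
      using X by blast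
  next
    assume R: "X \<in> carrier_mat n n \<and> (\<forall>a\<in>carrier_vec n. \<forall>b\<in>carrier_vec n.
        dderiv (X *\<^sub>v a) (dderiv b f) = dderiv a (dderiv (X *\<^sub>v b) f))"
    have Xu: "X *\<^sub>v unit_vec n j = col X j" if "j < n" for j
      using X that by (rule mult_mat_unit_vec)
    have "mpderiv i (dderiv (col X j) f) = mpderiv j (dderiv (col X i) f)" if "i < n" "j < n" for i j
      using R[THEN conjunct2, rule_format, OF unit_vec_carrier unit_vec_carrier, of j i] that
      by (simp add: Xu dderiv_unit_vec mpderiv_dderiv)
    then show "X \<in> center n f" using X by (simp add: center_iff_col)
  qed
qed (simp add: center_def)

lemma center_carrier: "X \<in> center n f \<Longrightarrow> X \<in> carrier_mat n n"
  by (simp add: center_def)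

lemma center_swap:
  "X \<in> center n f \<Longrightarrow> a \<in> carrier_vec n \<Longrightarrow> b \<in> carrier_vec n \<Longrightarrow>
     dderiv (X *\<^sub>v a) (dderiv b f) = dderiv a (dderiv (X *\<^sub>v b) f)"
  by (simp add: center_iff)

text \<open>By the chain rule the condition at a, b becomes a condition on f at Pa, Pb; there P
  (QXP) a = X (Pa), which is self-adjointness of X.\<close>

lemma center_conjugate:
  assumes P: "P \<in> carrier_mat n n" and Q: "Q \<in> carrier_mat n n" and PQ: "P * Q = 1\<^sub>m n"
    and f: "mvars f \<subseteq> {..<n}" and X: "X \<in> center n f"
  shows "Q * X * P \<in> center n (lin_subst n P f)"
proof -
  have Xc: "X \<in> carrier_mat n n" using X by (rule center_carrier)
  have cancel: "P *\<^sub>v ((Q * X * P) *\<^sub>v a) = X *\<^sub>v (P *\<^sub>v a)" if a: "a \<in> carrier_vec n" for a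
  proof -
    have "P *\<^sub>v ((Q * X * P) *\<^sub>v a) = (P * (Q * X * P)) *\<^sub>v a"
      using P Q Xc a by (intro assoc_mult_mat_vec[symmetric]) auto
    also have "P * (Q * X * P) = (P * Q) * (X * P)"
      using P Q Xc by (simp add: assoc_mult_mat[of _ n n _ n _ n])
    also have "\<dots> = X * P" using PQ P Xc by simp
    also have "(X * P) *\<^sub>v a = X *\<^sub>v (P *\<^sub>v a)"
      using P Xc a by (intro assoc_mult_mat_vec) auto
    finally show ?thesis .
  qed
  show ?thesis
    unfolding center_iff
  proof (intro conjI ballI)
    show "Q * X * P \<in> carrier_mat n n" using P Q Xc by auto
    then have Y: "(Q * X * P) *\<^sub>v v \<in> carrier_vec n" if "v \<in> carrier_vec n" for v
      using that by simp
    fix a b :: "'a vec" assume a: "a \<in> carrier_vec n" and b: "b \<in> carrier_vec n"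
    note chain = dderiv_lin_subst[OF P f] dderiv_lin_subst[OF P subset_trans[OF mvars_dderiv f]]
    have "P *\<^sub>v a \<in> carrier_vec n" "P *\<^sub>v b \<in> carrier_vec n" using P a b by auto
    then show "dderiv ((Q * X * P) *\<^sub>v a) (dderiv b (lin_subst n P f)) =
        dderiv a (dderiv ((Q * X * P) *\<^sub>v b) (lin_subst n P f))"
      using a b by (simp only: chain Y cancel center_swap[OF X])
  qed
qed

lemma center_one: "1\<^sub>m n \<in> center n f"
  by (simp add: center_iff)

lemma center_add: "X \<in> center n f \<Longrightarrow> Y \<in> center n f \<Longrightarrow> X + Y \<in> center n f"
  unfolding center_iff_col
  by (auto simp: col_add[of _ n n] dderiv_add_vec[of _ n] mpderiv_add)

lemma center_smult: "X \<in> center n f \<Longrightarrow> c \<cdot>\<^sub>m X \<in> center n f"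
  unfolding center_iff_col by (auto simp: dderiv_smult_vec)

lemma center_zero: "0\<^sub>m n n \<in> center n f"
  by (simp add: center_iff_col col_zero)

section \<open>The commutative algebra attached to a nondegenerate form\<close>

locale nondegenerate_form =
  fixes d n :: nat and f :: "'k::field mpoly"
  assumes d: "d \<ge> 3"
    and char: "CHAR('k) = 0 \<or> CHAR('k) > d"
    and form: "is_form d n f"
    and nondegenerate: "nondegenerate n f"
begin

lemma mvars_f: "mvars f \<subseteq> {..<n}"
  using form by (simp add: is_form_iff)

text \<open>The trilinear form has no kernel. All second derivatives of D(c) f vanish, hence its
  first derivatives, of degree d - 2 > 0, hence D(c) f itself, and nondegeneracy gives c =
  0.\<close>

lemma dderiv_eq_0_imp:
  assumes c: "c \<in> carrier_vec n"
    and zero: "\<And>v w. v \<in> carrier_vec n \<Longrightarrow> w \<in> carrier_vec n \<Longrightarrow> dderiv c (dderiv v (dderiv w f)) = 0"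
  shows "c = 0\<^sub>v n"
proof -
  have q: "is_form (d - 1) n (dderiv c f)" using is_form_dderiv[OF form] .
  have "mpderiv j (dderiv c f) = 0" if j: "j < n" for j
  proof (rule homogeneous_eq_0_of_mpderiv_eq_0[OF char is_form_mpderiv[OF q]])
    fix k assume k: "k < n"
    have "dderiv c (dderiv (unit_vec n k) (dderiv (unit_vec n j) f)) = 0"
      by (rule zero) auto
    then show "mpderiv k (mpderiv j (dderiv c f)) = 0"
      using j k by (simp add: dderiv_unit_vec mpderiv_dderiv)
  qed (use d in auto)
  then have "dderiv c f = 0"
    using d by (intro homogeneous_eq_0_of_mpderiv_eq_0[OF char q]) auto
  then show ?thesis
    using nondegenerate_dderiv[OF nondegenerate mvars_f c _ char form] by blast
qed

text \<open>
  Moving \<open>X\<close> and \<open>Y\<close> around the three slots of the symmetric trilinear form of third derivatives: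
  \<open>T(XYu,v,w) = T(Yu,v,Xw) = T(u,Yv,Xw) = T(Xu,Yv,w) = T(YXu,v,w)\<close>.
\<close>

lemma center_commute:
  assumes X: "X \<in> center n f" and Y: "Y \<in> center n f"
  shows "X * Y = Y * X"
proof -
  have c: "X \<in> carrier_mat n n" "Y \<in> carrier_mat n n" using X Y center_carrier by auto
  have slot3: "dderiv (Z *\<^sub>v a) (dderiv b (dderiv w f)) = dderiv a (dderiv b (dderiv (Z *\<^sub>v w) f))"
    if "Z \<in> center n f" "a \<in> carrier_vec n" "b \<in> carrier_vec n" "w \<in> carrier_vec n" for Z a b w
    by (simp only: dderiv_commute[of "Z *\<^sub>v a" b] center_swap[OF that(1,2,4)] dderiv_commute[of b a])
  have slot2: "dderiv (Z *\<^sub>v a) (dderiv b (dderiv w f)) = dderiv a (dderiv (Z *\<^sub>v b) (dderiv w f))"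
    if "Z \<in> center n f" "a \<in> carrier_vec n" "b \<in> carrier_vec n" "w \<in> carrier_vec n" for Z a b w
    by (simp only: dderiv_commute[of b w] dderiv_commute[of "Z *\<^sub>v a" w] center_swap[OF that(1,2,3)]
        dderiv_commute[of w a] dderiv_commute[of w "Z *\<^sub>v b"])
  have eq: "X *\<^sub>v (Y *\<^sub>v u) = Y *\<^sub>v (X *\<^sub>v u)" if u: "u \<in> carrier_vec n" for u
  proof -
    have vecs: "X *\<^sub>v v \<in> carrier_vec n" "Y *\<^sub>v v \<in> carrier_vec n" if "v \<in> carrier_vec n" for v
      using c that by auto
    \<comment> \<open>The commutator applied to u, to be placed in the kernel of the trilinear
      form.\<close>
    let ?c = "X *\<^sub>v (Y *\<^sub>v u) + (-1) \<cdot>\<^sub>v (Y *\<^sub>v (X *\<^sub>v u))"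
    have "?c = 0\<^sub>v n"
    proof (rule dderiv_eq_0_imp)
      show "?c \<in> carrier_vec n" using vecs u by simp
      fix v w :: "'k vec" assume v: "v \<in> carrier_vec n" and w: "w \<in> carrier_vec n"
      have "dderiv (X *\<^sub>v (Y *\<^sub>v u)) (dderiv v (dderiv w f)) =
          dderiv (Y *\<^sub>v u) (dderiv v (dderiv (X *\<^sub>v w) f))"
        using vecs u v w by (intro slot3[OF X])
      also have "\<dots> = dderiv u (dderiv (Y *\<^sub>v v) (dderiv (X *\<^sub>v w) f))"
        using vecs u v w by (intro slot2[OF Y])
      also have "\<dots> = dderiv (X *\<^sub>v u) (dderiv (Y *\<^sub>v v) (dderiv w f))"
        using vecs u v w by (intro slot3[OF X, symmetric])
      also have "\<dots> = dderiv (Y *\<^sub>v (X *\<^sub>v u)) (dderiv v (dderiv w f))"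
        using vecs u v w by (intro slot2[OF Y, symmetric])
      finally show "dderiv ?c (dderiv v (dderiv w f)) = 0"
        using vecs u
        by (subst dderiv_add_vec[of _ n])
          (simp_all add: dderiv_smult_vec mconst_def single_uminus)
    qed
    then have "?c $ i = 0" if "i < n" for i using that by (simp only: index_zero_vec)
    then show ?thesis using c by (intro eq_vecI) auto
  qed
  show ?thesis
  proof (rule mat_col_eqI)
    fix i assume "i < dim_col (Y * X)"
    then have i: "i < n" using c by simp
    have "(X * Y) *\<^sub>v unit_vec n i = (Y * X) *\<^sub>v unit_vec n i"
      using eq[of "unit_vec n i"] c by (simp add: assoc_mult_mat_vec[of _ n n _ n])
    then show "col (X * Y) i = col (Y * X) i"
      using c i by (simp add: mult_mat_unit_vec[of _ n n])
  qed (use c in auto)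
qed

text \<open>Moving the two factors across one after the other reverses their order, so closure under
  products rests on commutativity.\<close>

lemma center_mult:
  assumes X: "X \<in> center n f" and Y: "Y \<in> center n f"
  shows "X * Y \<in> center n f"
proof -
  have c: "X \<in> carrier_mat n n" "Y \<in> carrier_mat n n" using X Y center_carrier by auto
  have "dderiv ((X * Y) *\<^sub>v a) (dderiv b f) = dderiv a (dderiv ((X * Y) *\<^sub>v b) f)"
    if "a \<in> carrier_vec n" "b \<in> carrier_vec n" for a b
  proof -
    have "dderiv ((X * Y) *\<^sub>v a) (dderiv b f) = dderiv (X *\<^sub>v (Y *\<^sub>v a)) (dderiv b f)"
      using c that by simp
    also have "\<dots> = dderiv a (dderiv (Y *\<^sub>v (X *\<^sub>v b)) f)"
      using c that center_swap[OF X] center_swap[OF Y] by simp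
    also have "Y *\<^sub>v (X *\<^sub>v b) = (X * Y) *\<^sub>v b"
      unfolding center_commute[OF X Y] using c that by simp
    finally show ?thesis .
  qed
  then show ?thesis using c by (simp add: center_iff)
qed

end

section \<open>Semisimplicity of the center\<close>

definition lincomb_mat :: "nat \<Rightarrow> ('i \<Rightarrow> 'k::comm_ring_1) \<Rightarrow> ('i \<Rightarrow> 'k mat) \<Rightarrow> 'i set \<Rightarrow> 'k mat" where
  "lincomb_mat n c A I = mat n n (\<lambda>(r, s). \<Sum>i\<in>I. c i * A i $$ (r, s))"

lemma lincomb_mat_carrier [simp]: "lincomb_mat n c A I \<in> carrier_mat n n"
  by (simp add: lincomb_mat_def)

lemma lincomb_mat_mult:
  assumes "\<And>i. i \<in> I \<Longrightarrow> A i \<in> carrier_mat n n" "B \<in> carrier_mat n n"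
  shows "lincomb_mat n c A I * B = lincomb_mat n c (\<lambda>i. A i * B) I"
proof (rule eq_matI)
  fix r s assume "r < dim_row (lincomb_mat n c (\<lambda>i. A i * B) I)"
    "s < dim_col (lincomb_mat n c (\<lambda>i. A i * B) I)"
  then have rs: "r < n" "s < n" by (simp_all add: lincomb_mat_def)
  have "(lincomb_mat n c A I * B) $$ (r, s) = (\<Sum>t<n. \<Sum>i\<in>I. c i * (A i $$ (r, t) * B $$ (t, s)))"
    using rs assms(2)
    by (simp add: lincomb_mat_def scalar_prod_def lessThan_atLeast0 sum_distrib_right mult.assoc)
  also have "\<dots> = (\<Sum>i\<in>I. \<Sum>t<n. c i * (A i $$ (r, t) * B $$ (t, s)))" by (rule sum.swap)
  also have "\<dots> = (\<Sum>i\<in>I. c i * (A i * B) $$ (r, s))"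
  proof (intro sum.cong refl)
    fix i assume "i \<in> I"
    then have "A i \<in> carrier_mat n n" by (rule assms(1))
    then show "(\<Sum>t<n. c i * (A i $$ (r, t) * B $$ (t, s))) = c i * (A i * B) $$ (r, s)"
      using rs assms(2) by (simp add: scalar_prod_def lessThan_atLeast0 sum_distrib_left)
  qed
  finally show "(lincomb_mat n c A I * B) $$ (r, s) = lincomb_mat n c (\<lambda>i. A i * B) I $$ (r, s)"
    using rs by (simp add: lincomb_mat_def)
qed (use assms in \<open>auto simp: lincomb_mat_def\<close>)

text \<open>The matrices, flattened to columns of length n^2, are padded with zero rows to a square
  matrix of size N; it is singular, and a kernel vector gives the coefficients.\<close>

lemma mat_family_dependent:
  fixes A :: "nat \<Rightarrow> 'k::field mat"
  assumes "n * n < N"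
  obtains c i where "i < N" "c i \<noteq> 0" "lincomb_mat n c A {..<N} = 0\<^sub>m n n"
proof -
  define M where "M = mat N N (\<lambda>(q, i). if q < n * n then A i $$ (q div n, q mod n) else 0)"
  have Mc: "M \<in> carrier_mat N N" by (simp add: M_def)
  \<comment> \<open>Row n * n exists since n * n < N, and it is zero; scaling it by 0 changes
    nothing, so det M = 0 * det M.\<close>
  have "multrow (n * n) 0 M = M" by (intro eq_matI) (auto simp: M_def)
  then have "det M = 0" using det_multrow[OF assms Mc, of 0] by simp
  then obtain v where v: "v \<in> carrier_vec N" "v \<noteq> 0\<^sub>v N" "M *\<^sub>v v = 0\<^sub>v N"
    using det_0_iff_vec_prod_zero[OF Mc] by blast
  obtain i where i: "i < N" "v $ i \<noteq> 0"
    using v(1,2) by (metis carrier_vecD eq_vecI index_zero_vec(1,2))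
  have "lincomb_mat n (vec_index v) A {..<N} = 0\<^sub>m n n"
  proof (rule eq_matI)
    fix r s assume "r < dim_row (0\<^sub>m n n :: 'k mat)" "s < dim_col (0\<^sub>m n n :: 'k mat)"
    then have rs: "r < n" "s < n" by simp_all
    let ?q = "r * n + s"
    have "(r + 1) * n \<le> n * n" using rs by (intro mult_le_mono1) simp
    then have q: "?q < n * n" using rs(2) by simp
    have dm: "?q div n = r" "?q mod n = s" using rs by simp_all
    have "(M *\<^sub>v v) $ ?q = (\<Sum>i<N. A i $$ (r, s) * v $ i)"
      using q assms v(1) dm by (simp add: M_def scalar_prod_def lessThan_atLeast0)
    then show "lincomb_mat n (vec_index v) A {..<N} $$ (r, s) = 0\<^sub>m n n $$ (r, s)"
      using v(3) q assms rs by (simp add: lincomb_mat_def mult.commute)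
  qed (simp_all add: lincomb_mat_def)
  with i that show ?thesis by blast
qed

lemma center_lincomb_mat:
  assumes "finite I" "\<And>i. i \<in> I \<Longrightarrow> A i \<in> center n f"
  shows "lincomb_mat n c A I \<in> center n f"
  using assms
proof (induction I)
  case empty
  have "lincomb_mat n c A {} = 0\<^sub>m n n" by (intro eq_matI) (auto simp: lincomb_mat_def)
  then show ?case by (simp add: center_zero)
next
  case (insert i I)
  have "A i \<in> carrier_mat n n" using insert.prems center_carrier by blast
  then have "lincomb_mat n c A (insert i I) = c i \<cdot>\<^sub>m A i + lincomb_mat n c A I"
    using insert.hyps by (intro eq_matI) (auto simp: lincomb_mat_def)
  then show ?case using insert by (simp add: center_add center_smult)
qed

section \<open>The center as a ring, and its semisimplicity\<close>

context nondegenerate_form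
begin

lemma center_algebra_simps [simp]:
  "carrier (center_algebra n f) = center n f"
  "mult (center_algebra n f) = (*)"
  "add (center_algebra n f) = (+)"
  "one (center_algebra n f) = 1\<^sub>m n"
  "zero (center_algebra n f) = 0\<^sub>m n n"
  by (simp_all add: center_algebra_def ring_mat_def)

lemma cring_center_algebra: "cring (center_algebra n f)"
proof -
  interpret M: ring "ring_mat TYPE('k) n ()" by (rule ring_mat)
  have "subring (center n f) (ring_mat TYPE('k) n ())"
  proof (rule M.subringI)
    show "center n f \<subseteq> carrier (ring_mat TYPE('k) n ())"
      using center_carrier by (auto simp: ring_mat_simps)
    fix X assume X: "X \<in> center n f"
    then have Xc: "X \<in> carrier_mat n n" by (rule center_carrier)
    \<comment> \<open>Identifying the abstract negative with a scalar multiple reduces closure to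
      \<open>center_smult\<close>.\<close>
    have "\<ominus>\<^bsub>ring_mat TYPE('k) n ()\<^esub> X = (-1) \<cdot>\<^sub>m X"
    proof (rule M.minus_equality)
      show "(-1) \<cdot>\<^sub>m X \<oplus>\<^bsub>ring_mat TYPE('k) n ()\<^esub> X = \<zero>\<^bsub>ring_mat TYPE('k) n ()\<^esub>"
        using Xc by (intro eq_matI) (auto simp: ring_mat_simps)
    qed (use Xc in \<open>auto simp: ring_mat_simps\<close>)
    then show "\<ominus>\<^bsub>ring_mat TYPE('k) n ()\<^esub> X \<in> center n f"
      using center_smult[OF X] by simp
  qed (auto simp: ring_mat_simps center_one center_mult center_add)
  then have "ring (center_algebra n f)"
    unfolding center_algebra_def by (rule M.subring_is_ring)
  then interpret ring "center_algebra n f" .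
  show ?thesis by unfold_locales (simp add: center_commute)
qed

lemma semisimple_center_algebra_iff:
  "semisimple (center_algebra n f) \<longleftrightarrow> (\<forall>X\<in>center n f. X * X = 0\<^sub>m n n \<longrightarrow> X = 0\<^sub>m n n)"
proof
  interpret R: cring "center_algebra n f" by (rule cring_center_algebra)
  show "\<forall>X\<in>center n f. X * X = 0\<^sub>m n n \<longrightarrow> X = 0\<^sub>m n n" if "semisimple (center_algebra n f)"
    using R.semisimple_imp_reduced[OF that] by simp
  assume reduced: "\<forall>X\<in>center n f. X * X = 0\<^sub>m n n \<longrightarrow> X = 0\<^sub>m n n"
  let ?R = "center_algebra n f"
  show "semisimple ?R"
  proof (rule R.reduced_imp_semisimple)
    fix a assume "a \<in> carrier ?R" "a \<otimes>\<^bsub>?R\<^esub> a = \<zero>\<^bsub>?R\<^esub>"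
    then show "a = \<zero>\<^bsub>?R\<^esub>" using reduced by simp
  next
    fix a assume a: "a \<in> carrier ?R"
    define A where "A i = a [^]\<^bsub>?R\<^esub> (i::nat)" for i
    have A: "A i \<in> center n f" for i using R.nat_pow_closed[OF a, of i] by (simp add: A_def)
    have A_mult: "A i * A j = A (i + j)" for i j
      using R.nat_pow_mult[OF a, of i j] by (simp add: A_def)
    \<comment> \<open>One more power than the dimension of the matrix space, so that the powers are
      dependent.\<close>
    define N where "N = n * n + 1"
    then have "n * n < N" by simp
    then obtain c i where ci: "i < N" "c i \<noteq> 0" and dep: "lincomb_mat n c A {..<N} = 0\<^sub>m n n"
      by (rule mat_family_dependent)
    \<comment> \<open>The lowest power in the relation. Dividing by its coefficient expresses a^r
      through higher powers, all of which contain the factor a^(r+1); \<open>?C\<close> collects the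
      cofactors.\<close>
    define r where "r = (LEAST i. c i \<noteq> 0)"
    have cr: "c r \<noteq> 0" unfolding r_def using ci(2) by (rule LeastI)
    have "r \<le> i" unfolding r_def using ci(2) by (rule Least_le)
    then have rN: "r < N" using ci(1) by simp
    have c0: "c j = 0" if "j < r" for j using not_less_Least that unfolding r_def by blast
    let ?C = "lincomb_mat n (\<lambda>j. - c j / c r) (\<lambda>j. A (j - Suc r)) {Suc r..<N}"
    have C: "?C \<in> center n f" by (intro center_lincomb_mat A) auto
    have "?C * A (Suc r) = lincomb_mat n (\<lambda>j. - c j / c r) (\<lambda>j. A (j - Suc r) * A (Suc r)) {Suc r..<N}"
      by (intro lincomb_mat_mult center_carrier[OF A])
    also have "\<dots> = A r"
    proof (rule eq_matI)
      fix s t assume "s < dim_row (A r)" "t < dim_col (A r)"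
      then have st: "s < n" "t < n" using center_carrier[OF A[of r]] by auto
      have "0 = (\<Sum>j<N. c j * A j $$ (s, t))"
        using arg_cong[OF dep, of "\<lambda>M. M $$ (s, t)"] st by (simp add: lincomb_mat_def)
      also have "\<dots> = (\<Sum>j\<in>insert r {Suc r..<N}. c j * A j $$ (s, t))"
        using rN c0 by (intro sum.mono_neutral_right) (auto simp: not_less_eq_eq le_less)
      also have "\<dots> = c r * A r $$ (s, t) + (\<Sum>j\<in>{Suc r..<N}. c j * A j $$ (s, t))" by simp
      finally have "A r $$ (s, t) = - (\<Sum>j\<in>{Suc r..<N}. c j * A j $$ (s, t)) / c r"
        using cr by (simp add: field_simps eq_neg_iff_add_eq_0)
      then show "lincomb_mat n (\<lambda>j. - c j / c r) (\<lambda>j. A (j - Suc r) * A (Suc r)) {Suc r..<N} $$ (s, t)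
          = A r $$ (s, t)"
        using st by (simp add: lincomb_mat_def A_mult sum_negf sum_divide_distrib)
    qed (use center_carrier[OF A[of r]] in \<open>auto simp: lincomb_mat_def\<close>)
    finally have "a [^]\<^bsub>?R\<^esub> r = ?C \<otimes>\<^bsub>?R\<^esub> a [^]\<^bsub>?R\<^esub> (Suc r)" by (simp add: A_def del: R.nat_pow_Suc)
    then show "\<exists>c\<in>carrier ?R. \<exists>r::nat. a [^]\<^bsub>?R\<^esub> r = c \<otimes>\<^bsub>?R\<^esub> a [^]\<^bsub>?R\<^esub> (Suc r)"
      using C by auto
  next
    fix m e assume oi: "R.orthogonal_idempotents m e"
    have e: "e i \<in> center n f" "e i \<noteq> 0\<^sub>m n n" if "i < m" for i
      using oi that by (auto simp: R.orthogonal_idempotents_def)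
    have ee: "e i * e j = (if i = j then e i else 0\<^sub>m n n)" if "i < m" "j < m" for i j
      using oi that by (auto simp: R.orthogonal_idempotents_def)
    show "m \<le> n * n"
    proof (rule ccontr)
      assume "\<not> m \<le> n * n"
      then have "n * n < m" by simp
      then obtain c i where ci: "i < m" "c i \<noteq> 0" and dep: "lincomb_mat n c e {..<m} = 0\<^sub>m n n"
        by (rule mat_family_dependent)
      have eic: "e i \<in> carrier_mat n n" using e(1)[OF ci(1)] by (rule center_carrier)
      \<comment> \<open>Multiplying the relation by e_i leaves only c_i e_i, which would then be
        0.\<close>
      have "lincomb_mat n c (\<lambda>j. e j * e i) {..<m} = lincomb_mat n c e {..<m} * e i"
        using e(1) ci(1) by (intro lincomb_mat_mult[symmetric] center_carrier) auto
      also have "\<dots> = 0\<^sub>m n n" using dep eic by simp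
      finally have L: "lincomb_mat n c (\<lambda>j. e j * e i) {..<m} = 0\<^sub>m n n" .
      have "e i $$ (s, t) = 0" if st: "s < n" "t < n" for s t
      proof -
        have "0 = (\<Sum>j<m. c j * (e j * e i) $$ (s, t))"
          using arg_cong[OF L, of "\<lambda>M. M $$ (s, t)"] st by (simp add: lincomb_mat_def)
        also have "\<dots> = (\<Sum>j<m. if i = j then c i * e i $$ (s, t) else 0)"
          using ee ci(1) st by (intro sum.cong) auto
        also have "\<dots> = c i * e i $$ (s, t)" using ci(1) by simp
        finally show ?thesis using ci(2) by simp
      qed
      then have "e i = 0\<^sub>m n n" using eic by (intro eq_matI) auto
      then show False using e(2)[OF ci(1)] by simp
    qed
  qed
qed

section \<open>Square-zero elements of the center and LDS forms\<close>

lemma square_zero_center_imp_LDS: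
  assumes X: "X \<in> center n f" and sq: "X * X = 0\<^sub>m n n" and nz: "X \<noteq> 0\<^sub>m n n"
  shows "is_LDS d n f"
proof -
  have Xc: "X \<in> carrier_mat n n" using X by (rule center_carrier)
  obtain P l where P: "P \<in> carrier_mat n n" "invertible_mat P" and l: "1 \<le> l" "2 * l \<le> n"
    and act1: "\<And>i. i < l \<Longrightarrow> X *\<^sub>v col P (l + i) = col P i"
    and act2: "\<And>j. j < n \<Longrightarrow> \<not> (l \<le> j \<and> j < 2 * l) \<Longrightarrow> X *\<^sub>v col P j = 0\<^sub>v n"
    using square_zero_mat_normal_form[OF Xc sq nz] by metis
  obtain Q where Q: "Q \<in> carrier_mat n n" "P * Q = 1\<^sub>m n" "Q * P = 1\<^sub>m n"
    using invertible_mat_obtain_inverse[OF P] .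
  define F where "F = lin_subst n P f"
  have F: "is_form d n F" unfolding F_def using is_form_lin_subst[OF form] .
  define Y where "Y = Q * X * P"
  have Y: "Y \<in> center n F" unfolding Y_def F_def by (rule center_conjugate[OF P(1) Q(1,2) mvars_f X])
  have colY: "col Y j = Q *\<^sub>v (X *\<^sub>v col P j)" if "j < n" for j
  proof -
    have "col Y j = Y *\<^sub>v unit_vec n j" using center_carrier[OF Y] that by (simp add: mult_mat_unit_vec)
    also have "\<dots> = Q *\<^sub>v (X *\<^sub>v (P *\<^sub>v unit_vec n j))"
      unfolding Y_def using P Q Xc by (simp add: assoc_mult_mat_vec[of _ n n _ n])
    finally show ?thesis using P(1) that by (simp add: mult_mat_unit_vec)
  qed
  have colQP: "Q *\<^sub>v col P i = unit_vec n i" if "i < n" for i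
    using P(1) Q(1) that by (simp add: mult_mat_unit_vec[of P n n, symmetric] assoc_mult_mat_vec[of Q n n P n, symmetric] Q(3))
  \<comment> \<open>The i-th derivative of \<open>G j\<close> is the entry (i, j) of the Hessian of
    F times Y. In these coordinates Y sends e_(l+i) to e_i for i < l and the other unit vectors to
    0.\<close>
  define G where "G j = dderiv (col Y j) F" for j
  have Gsym: "mpderiv i (G j) = mpderiv j (G i)" if "i < n" "j < n" for i j
    using Y that by (simp add: G_def center_iff_col)
  have G1: "G (l + i) = mpderiv i F" if "i < l" for i
    using that l colY[of "l + i"] act1[OF that] colQP[of i] by (simp add: G_def dderiv_unit_vec)
  have G2: "G j = 0" if "j < n" "\<not> (l \<le> j \<and> j < 2 * l)" for j
  proof -
    have "Q *\<^sub>v 0\<^sub>v n = 0\<^sub>v n" using Q(1) by (intro eq_vecI) auto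
    then show ?thesis using colY[OF that(1)] act2[OF that] by (simp add: G_def)
  qed
  have Fi: "is_form (d - 1) n (mpderiv i F)" for i using is_form_mpderiv[OF F] .
  \<comment> \<open>As the i-th derivative of F is \<open>G (l + i)\<close>, symmetry turns its j-th
    derivative into a derivative of \<open>G j\<close>, and \<open>G j\<close> is 0 outside the
    block.\<close>
  have Fij: "mpderiv j (mpderiv i F) = 0" if "i < l" "j < n" "\<not> (l \<le> j \<and> j < 2 * l)" for i j
    using Gsym[of j "l + i"] G1[OF that(1)] G2[OF that(2,3)] that l by simp
  have vars: "mvars (mpderiv i F) \<subseteq> {l..<2 * l}" if i: "i < l" for i
  proof
    fix j assume j: "j \<in> mvars (mpderiv i F)"
    then have "j < n" using Fi[of i] by (auto simp: is_form_iff)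
    moreover have "mpderiv j (mpderiv i F) \<noteq> 0"
      using notin_mvars_of_mpderiv_eq_0[OF char, of "d - 1" "mpderiv i F" j] Fi[of i] j
      by (auto simp: is_form_iff)
    ultimately show "j \<in> {l..<2 * l}" using Fij[OF i, of j] by auto
  qed
  \<comment> \<open>The integrability condition: it makes the derivatives of F by the first l
    variables a gradient in the second block.\<close>
  have Fsym: "mpderiv (l + k) (mpderiv i F) = mpderiv (l + i) (mpderiv k F)" if "i < l" "k < l" for i k
    using Gsym[of "l + k" "l + i"] G1 that l by simp
  have dnz: "(of_nat d :: 'k) \<noteq> 0" using of_nat_neq_0_of_char[OF char, of d] d by simp
  \<comment> \<open>The potential of that gradient. Differentiating the sum gives the wanted
    derivative once from the explicit factor and d - 1 times from Euler's identity in degree d - 1,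
    hence the factor 1/d.\<close>
  define h where "h = mconst (inverse (of_nat d)) * (\<Sum>i<l. mvar (l + i) * mpderiv i F)"
  have h_deriv: "mpderiv (l + k) h = mpderiv k F" if k: "k < l" for k
  proof -
    have "mpderiv (l + k) (\<Sum>i<l. mvar (l + i) * mpderiv i F) =
        (\<Sum>i<l. (if i = k then mpderiv k F else 0) + mvar (l + i) * mpderiv (l + i) (mpderiv k F))"
      unfolding mpderiv_sum using k
      by (intro sum.cong) (auto simp: mpderiv_mult mpderiv_mvar Fsym)
    also have "\<dots> = mpderiv k F + (\<Sum>i<l. mvar (l + i) * mpderiv (l + i) (mpderiv k F))"
      using k by (simp add: sum.distrib sum.delta)
    also have "(\<Sum>i<l. mvar (l + i) * mpderiv (l + i) (mpderiv k F)) =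
        (\<Sum>i\<in>{l..<2 * l}. mvar i * mpderiv i (mpderiv k F))"
      by (rule sum.reindex_bij_witness[of _ "\<lambda>i. i - l" "\<lambda>i. l + i"]) auto
    also have "\<dots> = mconst (of_nat (d - 1)) * mpderiv k F"
      using Fi[of k] vars[OF k] by (intro euler_identity) (auto simp: is_form_iff)
    also have "mpderiv k F + mconst (of_nat (d - 1)) * mpderiv k F = mconst (1 + of_nat (d - 1)) * mpderiv k F"
      by (simp add: mconst_add distrib_right)
    also have "(1 + of_nat (d - 1) :: 'k) = of_nat d"
      using d by (simp add: of_nat_diff)
    finally show ?thesis
      using dnz by (simp add: h_def mult.assoc[symmetric] mconst_mult[symmetric])
  qed
  have h_vars: "mvars h \<subseteq> {l..<l + l}"
    unfolding h_def
  proof (rule subset_trans[OF mvars_mconst_mult], rule mvars_sum)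
    fix i assume "i \<in> {..<l}"
    then have "mvars (mvar (l + i) :: 'k mpoly) \<union> mvars (mpderiv i F) \<subseteq> {l..<l + l}"
      using vars[of i] by (auto simp: mult_2)
    then show "mvars (mvar (l + i) * mpderiv i F) \<subseteq> {l..<l + l}"
      by (rule subset_trans[OF mvars_mult])
  qed
  have h_hom: "homogeneous d h"
    unfolding h_def using Fi d
    by (intro homogeneous_mconst_mult homogeneous_sum homogeneous_mvar_mult) (auto simp: is_form_iff)
  obtain h0 where h0: "is_form d l h0" "shift_vars l h0 = h"
    using obtain_shift_vars[OF h_hom h_vars] .
  \<comment> \<open>By \<open>Fij\<close>, F is linear in the first l variables jointly; removing
    the linear part frees the remainder from them.\<close>
  define g where "g = F - (\<Sum>i<l. mvar i * mpderiv i F)"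
  have g_hom: "homogeneous d g"
    unfolding g_def using Fi F d
    by (intro homogeneous_minus homogeneous_sum homogeneous_mvar_mult) (auto simp: is_form_iff)
  have g_vars: "mvars g \<subseteq> {l..<l + (n - l)}"
  proof
    fix j assume j: "j \<in> mvars g"
    have "mvars (mvar i * mpderiv i F) \<subseteq> {..<n}" if "i < l" for i
      using mvars_mult[of "mvar i" "mpderiv i F"] Fi[of i] that l by (auto simp: is_form_iff)
    then have "mvars (\<Sum>i<l. mvar i * mpderiv i F) \<subseteq> {..<n}" by (intro mvars_sum) auto
    then have "j < n"
      using j F mvars_minus[of F "\<Sum>i<l. mvar i * mpderiv i F"] by (auto simp: g_def is_form_iff)
    moreover have "\<not> j < l"
    proof
      assume jl: "j < l"
      have "mpderiv j (\<Sum>i<l. mvar i * mpderiv i F) = (\<Sum>i<l. if i = j then mpderiv i F else 0)"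
        unfolding mpderiv_sum using jl l
        by (intro sum.cong) (auto simp: mpderiv_mult mpderiv_mvar Fij)
      also have "\<dots> = mpderiv j F" using jl by simp
      finally have "mpderiv j g = 0" by (simp add: g_def mpderiv_minus)
      then show False using notin_mvars_of_mpderiv_eq_0[OF char g_hom] j by blast
    qed
    ultimately show "j \<in> {l..<l + (n - l)}" by auto
  qed
  obtain g0 where g0: "is_form d (n - l) g0" "shift_vars l g0 = g"
    using obtain_shift_vars[OF g_hom g_vars] .
  have "F = (\<Sum>i<l. mvar i * mpderiv (l + i) (shift_vars l h0)) + shift_vars l g0"
    by (simp add: h0(2) g0(2) h_deriv g_def)
  then show ?thesis
    unfolding is_LDS_def F_def using P l h0(1) g0(1) by blast
qed

lemma LDS_imp_square_zero_center:
  assumes "is_LDS d n f"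
  obtains X where "X \<in> center n f" "X * X = 0\<^sub>m n n" "X \<noteq> 0\<^sub>m n n"
proof -
  obtain P l h0 g0 where P: "P \<in> carrier_mat n n" "invertible_mat P"
    and l: "1 \<le> l" "2 * l \<le> n" and h0: "is_form d l h0" and g0: "is_form d (n - l) g0"
    and eq: "lin_subst n P f =
      (\<Sum>i<l. mvar i * mpderiv (l + i) (shift_vars l h0)) + shift_vars l g0"
    using assms unfolding is_LDS_def by blast
  obtain Q where Q: "Q \<in> carrier_mat n n" "P * Q = 1\<^sub>m n" "Q * P = 1\<^sub>m n"
    using invertible_mat_obtain_inverse[OF P] .
  define F where "F = lin_subst n P f"
  define h where "h = shift_vars l h0"
  define g where "g = shift_vars l g0"
  have F_eq: "F = (\<Sum>i<l. mvar i * mpderiv (l + i) h) + g" by (simp add: F_def h_def g_def eq)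
  have hv: "mvars h \<subseteq> {l..<l + l}" and gv: "mvars g \<subseteq> {l..<l + (n - l)}"
    using h0 g0 by (auto simp: h_def g_def is_form_iff intro!: mvars_shift_vars)
  have h0': "mpderiv j h = 0" if "\<not> (l \<le> j \<and> j < 2 * l)" for j
    using hv that by (intro mpderiv_eq_0_of_notin_mvars) auto
  have Fi: "mpderiv j F = mpderiv (l + j) h" if j: "j < l" for j
  proof -
    have "mpderiv j g = 0" using gv j by (intro mpderiv_eq_0_of_notin_mvars) auto
    moreover have "mpderiv j (\<Sum>i<l. mvar i * mpderiv (l + i) h) =
        (\<Sum>i<l. if i = j then mpderiv (l + i) h else 0)"
      unfolding mpderiv_sum using j h0'[of j]
      by (intro sum.cong) (auto simp: mpderiv_mult mpderiv_mvar mpderiv_commute[of j])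
    ultimately show ?thesis using j by (simp add: F_eq mpderiv_add)
  qed
  \<comment> \<open>The normal form of a square-zero matrix of rank l; it depends on l and n alone,
    not on h and g.\<close>
  define N :: "'k mat" where "N = mat n n (\<lambda>(i, j). if i < l \<and> j = l + i then 1 else 0)"
  have Nc: "N \<in> carrier_mat n n" by (simp add: N_def)
  have colN: "col N j = (if l \<le> j \<and> j < 2 * l then unit_vec n (j - l) else 0\<^sub>v n)" if "j < n" for j
    using that l by (intro eq_vecI) (auto simp: N_def)
  \<comment> \<open>So the Hessian of F times N is the Hessian of h, and its symmetry is the
    commutation of partial derivatives.\<close>
  have GN: "dderiv (col N j) F = mpderiv j h" if "j < n" for j
    using that l Fi[of "j - l"] h0'[of j] by (auto simp: colN dderiv_unit_vec)
  have N: "N \<in> center n F"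
    using Nc by (auto simp: center_iff_col GN mpderiv_commute)
  have NN: "N * N = 0\<^sub>m n n"
    using l by (intro eq_matI) (auto simp: N_def scalar_prod_def intro!: sum.neutral)
  \<comment> \<open>The bounds 1 \<le> l and 2l \<le> n put this entry inside the matrix.\<close>
  have "N $$ (0, l) = 1" using l by (simp add: N_def)
  then have Nnz: "N \<noteq> 0\<^sub>m n n" using l by auto
  have f_eq: "lin_subst n Q F = f"
    unfolding F_def by (rule lin_subst_inverse[OF P(1) Q(1,2) mvars_f])
  have "mvars F \<subseteq> {..<n}" using is_form_lin_subst[OF form, of P] by (simp add: F_def is_form_iff)
  \<comment> \<open>Returning to f is the change of variables by Q, whose inverse is P, so N becomes
    P N Q.\<close>
  from center_conjugate[OF Q(1) P(1) Q(3) this N]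
  have X: "P * N * Q \<in> center n f" unfolding f_eq .
  note assoc = assoc_mult_mat[of _ n n _ n _ n]
  have QP: "Q * (P * M) = M" if "M \<in> carrier_mat n n" for M
    using that P Q by (simp add: assoc[symmetric])
  show ?thesis
  proof (rule that[OF X])
    have "(P * N * Q) * (P * N * Q) = P * (N * N) * Q"
      using P Q Nc by (simp add: assoc QP)
    then show "(P * N * Q) * (P * N * Q) = 0\<^sub>m n n"
      using P Q by (simp add: NN)
    show "P * N * Q \<noteq> 0\<^sub>m n n"
    proof
      assume z: "P * N * Q = 0\<^sub>m n n"
      have "N = Q * (P * N * Q) * P"
        using P Q Nc by (simp add: assoc QP)
      then show False using z Nnz P Q by simp
    qed
  qed
qed

end

theorem theorem3p6:
  fixes d n :: nat and f :: "'k::alg_closed_field mpoly"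
  assumes "d \<ge> 3" and "n \<ge> 1"
    and "CHAR('k) = 0 \<or> CHAR('k) > d"
    and "is_form d n f"
    and "nondegenerate n f"
  shows "\<not> semisimple (center_algebra n f) \<longleftrightarrow> is_LDS d n f"
proof -
  interpret nondegenerate_form d n f
    using assms by unfold_locales
  show ?thesis
    unfolding semisimple_center_algebra_iff
    using square_zero_center_imp_LDS LDS_imp_square_zero_center by blast
qed

end
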